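(* Let $\mathcal{I}$ be a normed ideal of a $\sigma$-finite, semifinite von Neumann algebra factor $\mathcal{B}$, with ideal norm $\|\cdot\|_{\mathcal{I}}$, endowed with a trace $\tau_{\mathcal{I}}:\mathcal{I}\to\mathbb{C}$ that is positive and $\|\cdot\|_{\mathcal{I}}$-bounded, and assume $\tau_{\mathcal{I}}(\mathcal{I}^2)=\{0\}$. Let $H_0=aI$ for some $a\in\mathbb{R}$, and let $V=V^*\in\mathcal{I}$. Let $\Omega=\operatorname{conv}\big(\sigma(H_0)\cup\sigma(H_0+V)\big)$ and let $\mu_{H_0,V}$ be the unique complex measure on $\Omega$ such that $$\tau_{\mathcal{I}}\big(f(H_0+V)-f(H_0)\big)=\int_\Omega f'(\lambda)\,\mu_{H_0,V}(d\lambda)\qquad\text{for all } f\in C^3(\mathbb{R}).$$ Then $\mu_{H_0,V}=\tau_{\mathcal{I}}(V)\,\delta_a$, where $\delta_a$ is the Dirac measure at $a$.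
   Context: An ideal of $\mathcal{B}$ means a two-sided ideal. A normed ideal is an ideal $\mathcal{I}$ of $\mathcal{B}$ with an ideal norm, i.e. a norm $\|\cdot\|_{\mathcal{I}}$ on $\mathcal{I}$ such that: (a) $A\in\mathcal{B}$, $B\in\mathcal{I}$, $0\le A\le B$ implies $\|A\|_{\mathcal{I}}\le\|B\|_{\mathcal{I}}$; (b) there is $K>0$ with $\|B\|\le K\|B\|_{\mathcal{I}}$ for all $B\in\mathcal{I}$; (c) $\|ABC\|_{\mathcal{I}}\le\|A\|\,\|B\|_{\mathcal{I}}\,\|C\|$ for $A,C\in\mathcal{B}$, $B\in\mathcal{I}$. A trace on $\mathcal{I}$ is a linear functional $\tau_{\mathcal{I}}:\mathcal{I}\to\mathbb{C}$ with $\tau_{\mathcal{I}}(AB)=\tau_{\mathcal{I}}(BA)$ for $A\in\mathcal{I}$, $B\in\mathcal{B}$; it is positive if $\tau_{\mathcal{I}}(A)\ge 0$ for $0\le A\in\mathcal{I}$, and $\|\cdot\|_{\mathcal{I}}$-bounded if there is $M>0$ with $|\tau_{\mathcal{I}}(A)|\le M\|A\|_{\mathcal{I}}$ for all $A\in\mathcal{I}$. For $\alpha>0$, $\mathcal{I}^\alpha=\{A\in\mathcal{B}:|A|^{1/\alpha}\in\mathcal{I}\}$, which is an ideal of $\mathcal{B}$ (and $\mathcal{I}^2$ is the span of products of two elements of $\mathcal{I}$). $f(H)$ for self-adjoint $H\in\mathcal{B}$ is given by continuous functional calculus. For $H_0=H_0^*\in\mathcal B$ and $V=V^*\in\mathcal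 I$, existence and uniqueness of the measure $\mu_{H_0,V}$ (the spectral shift measure) is a theorem of the same paper. *)

theory Defs
  imports "HOL-Probability.Giry_Monad" "HOL-Computational_Algebra.Polynomial"
begin

section \<open>Complex Hilbert spaces and bounded operators\<close>

text \<open>
  The real Hilbert space structure (norm, topology, real inner product) is the one of the
  underlying library classes; the complex inner product is linear in its first argument.
\<close>

class complex_hilbert_space = real_inner + complete_space +
  fixes scaleC :: "complex \<Rightarrow> 'a \<Rightarrow> 'a"  (infixr "*\<^sub>C" 75)
    and cinner :: "'a \<Rightarrow> 'a \<Rightarrow> complex"
  assumes scaleC_add_right: "c *\<^sub>C (x + y) = c *\<^sub>C x + c *\<^sub>C y"
    and scaleC_add_left: "(c + d) *\<^sub>C x = c *\<^sub>C x + d *\<^sub>C x"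
    and scaleC_scaleC: "c *\<^sub>C (d *\<^sub>C x) = (c * d) *\<^sub>C x"
    and scaleC_of_real: "complex_of_real r *\<^sub>C x = scaleR r x"
    and cinner_add_left: "cinner (x + y) z = cinner x z + cinner y z"
    and cinner_scaleC_left: "cinner (c *\<^sub>C x) y = c * cinner x y"
    and cinner_commute: "cinner y x = cnj (cinner x y)"
    and inner_eq_Re_cinner: "inner x y = Re (cinner x y)"

type_synonym 'a op = "'a \<Rightarrow>\<^sub>L 'a"

text \<open>
  Elements of \<^typ>\<open>'a op\<close> are merely real-linear; the bounded operators of the complex Hilbert
  space are the members of \<open>bop\<close>. Their norm is the operator norm of the library.
\<close>

definition bop :: "'a::complex_hilbert_space op set" where
  "bop = {T. \<forall>c x. blinfun_apply T (c *\<^sub>C x) = c *\<^sub>C blinfun_apply T x}"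

definition op_scaleC :: "complex \<Rightarrow> 'a::complex_hilbert_space op \<Rightarrow> 'a op" where
  "op_scaleC c T = Blinfun (\<lambda>x. c *\<^sub>C blinfun_apply T x)"

definition is_adjoint :: "'a::complex_hilbert_space op \<Rightarrow> 'a op \<Rightarrow> bool" where
  "is_adjoint S T \<longleftrightarrow> (\<forall>x y. cinner (blinfun_apply S x) y = cinner x (blinfun_apply T y))"

definition adj :: "'a::complex_hilbert_space op \<Rightarrow> 'a op" where
  "adj T = (THE S. S \<in> bop \<and> is_adjoint S T)"

definition selfadjoint :: "'a::complex_hilbert_space op \<Rightarrow> bool" where
  "selfadjoint T \<longleftrightarrow> T \<in> bop \<and> is_adjoint T T"

definition op_le :: "'a::complex_hilbert_space op \<Rightarrow> 'a op \<Rightarrow> bool" where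
  "op_le S T \<longleftrightarrow>
     (\<forall>x. cinner (blinfun_apply T x - blinfun_apply S x) x \<in> \<real>\<^sub>\<ge>\<^sub>0)"

definition projection :: "'a::complex_hilbert_space op \<Rightarrow> bool" where
  "projection P \<longleftrightarrow> selfadjoint P \<and> P o\<^sub>L P = P"

definition op_spectrum :: "'a::complex_hilbert_space op \<Rightarrow> complex set" where
  "op_spectrum T = {z. \<not> (\<exists>S\<in>bop.
      S o\<^sub>L (T - op_scaleC z id_blinfun) = id_blinfun \<and>
      (T - op_scaleC z id_blinfun) o\<^sub>L S = id_blinfun)}"


section \<open>Continuous functional calculus of self-adjoint operators\<close>

definition op_poly :: "complex poly \<Rightarrow> 'a::complex_hilbert_space op \<Rightarrow> 'a op" where
  "op_poly p T = (\<Sum>i\<le>degree p. op_scaleC (coeff p i) (((o\<^sub>L) T ^^ i) id_blinfun))"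

text \<open>
  For \<open>H\<close> self-adjoint and \<open>f\<close> continuous on the (real) spectrum of \<open>H\<close>, the operator \<open>f(H)\<close> is the
  common norm limit of \<open>p\<^sub>n(H)\<close> over all sequences of polynomials that converge to \<open>f\<close> uniformly
  on the spectrum. Values of \<open>f\<close> off the spectrum are irrelevant.
\<close>

definition cfc :: "(real \<Rightarrow> complex) \<Rightarrow> 'a::complex_hilbert_space op \<Rightarrow> 'a op" where
  "cfc f H = (THE T. \<forall>p :: nat \<Rightarrow> complex poly.
      uniform_limit {t. complex_of_real t \<in> op_spectrum H}
        (\<lambda>n t. poly (p n) (complex_of_real t)) f sequentially
      \<longrightarrow> (\<lambda>n. op_poly (p n) H) \<longlonglongrightarrow> T)"

definition op_abs :: "'a::complex_hilbert_space op \<Rightarrow> 'a op" where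
  "op_abs T = cfc (\<lambda>t. complex_of_real (sqrt t)) (adj T o\<^sub>L T)"

definition op_powr :: "'a::complex_hilbert_space op \<Rightarrow> real \<Rightarrow> 'a op" where
  "op_powr T s = cfc (\<lambda>t. complex_of_real (t powr s)) T"


section \<open>Von Neumann algebras\<close>

definition commutant :: "'a::complex_hilbert_space op set \<Rightarrow> 'a op set" where
  "commutant \<B> = {T \<in> bop. \<forall>S\<in>\<B>. T o\<^sub>L S = S o\<^sub>L T}"

definition von_neumann_algebra :: "'a::complex_hilbert_space op set \<Rightarrow> bool" where
  "von_neumann_algebra \<B> \<longleftrightarrow>
     \<B> \<subseteq> bop \<and> (\<forall>T\<in>\<B>. adj T \<in> \<B>) \<and> commutant (commutant \<B>) = \<B>"

definition vn_factor :: "'a::complex_hilbert_space op set \<Rightarrow> bool" where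
  "vn_factor \<B> \<longleftrightarrow> von_neumann_algebra \<B> \<and>
     \<B> \<inter> commutant \<B> = range (\<lambda>c. op_scaleC c id_blinfun)"

definition vn_sigma_finite :: "'a::complex_hilbert_space op set \<Rightarrow> bool" where
  "vn_sigma_finite \<B> \<longleftrightarrow>
     (\<forall>\<P> \<subseteq> \<B>. (\<forall>P\<in>\<P>. projection P \<and> P \<noteq> 0) \<and>
        (\<forall>P\<in>\<P>. \<forall>Q\<in>\<P>. P \<noteq> Q \<longrightarrow> P o\<^sub>L Q = 0) \<longrightarrow> countable \<P>)"

definition vn_pos :: "'a::complex_hilbert_space op set \<Rightarrow> 'a op set" where
  "vn_pos \<B> = {T \<in> \<B>. op_le 0 T}"

definition is_sup_in_pos ::
    "'a::complex_hilbert_space op set \<Rightarrow> 'a op set \<Rightarrow> 'a op \<Rightarrow> bool" where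
  "is_sup_in_pos \<B> D S \<longleftrightarrow> S \<in> vn_pos \<B> \<and> (\<forall>T\<in>D. op_le T S) \<and>
     (\<forall>R\<in>vn_pos \<B>. (\<forall>T\<in>D. op_le T R) \<longrightarrow> op_le S R)"

text \<open>Numerical traces on the positive cone, with value \<open>\<infinity>\<close> allowed.\<close>

definition cone_trace ::
    "'a::complex_hilbert_space op set \<Rightarrow> ('a op \<Rightarrow> ennreal) \<Rightarrow> bool" where
  "cone_trace \<B> \<phi> \<longleftrightarrow>
     (\<forall>S\<in>vn_pos \<B>. \<forall>T\<in>vn_pos \<B>. \<phi> (S + T) = \<phi> S + \<phi> T) \<and>
     (\<forall>T\<in>vn_pos \<B>. \<forall>r\<ge>0. \<phi> (r *\<^sub>R T) = ennreal r * \<phi> T) \<and>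
     (\<forall>T\<in>\<B>. \<phi> (adj T o\<^sub>L T) = \<phi> (T o\<^sub>L adj T))"

definition faithful_on_cone ::
    "'a::complex_hilbert_space op set \<Rightarrow> ('a op \<Rightarrow> ennreal) \<Rightarrow> bool" where
  "faithful_on_cone \<B> \<phi> \<longleftrightarrow> (\<forall>T\<in>vn_pos \<B>. \<phi> T = 0 \<longrightarrow> T = 0)"

definition normal_on_cone ::
    "'a::complex_hilbert_space op set \<Rightarrow> ('a op \<Rightarrow> ennreal) \<Rightarrow> bool" where
  "normal_on_cone \<B> \<phi> \<longleftrightarrow>
     (\<forall>D S. D \<noteq> {} \<and> D \<subseteq> vn_pos \<B> \<and>
        (\<forall>T\<in>D. \<forall>R\<in>D. \<exists>Q\<in>D. op_le T Q \<and> op_le R Q) \<and> is_sup_in_pos \<B> D S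
        \<longrightarrow> \<phi> S = (SUP T\<in>D. \<phi> T))"

definition semifinite_on_cone ::
    "'a::complex_hilbert_space op set \<Rightarrow> ('a op \<Rightarrow> ennreal) \<Rightarrow> bool" where
  "semifinite_on_cone \<B> \<phi> \<longleftrightarrow>
     (\<forall>T\<in>vn_pos \<B>. T \<noteq> 0 \<longrightarrow>
        (\<exists>S\<in>vn_pos \<B>. S \<noteq> 0 \<and> op_le S T \<and> \<phi> S < \<infinity>))"

definition vn_semifinite :: "'a::complex_hilbert_space op set \<Rightarrow> bool" where
  "vn_semifinite \<B> \<longleftrightarrow>
     (\<exists>\<phi>. cone_trace \<B> \<phi> \<and> faithful_on_cone \<B> \<phi> \<and> normal_on_cone \<B> \<phi> \<and>
        semifinite_on_cone \<B> \<phi>)"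


section \<open>Normed ideals and traces\<close>

definition op_ideal :: "'a::complex_hilbert_space op set \<Rightarrow> 'a op set \<Rightarrow> bool" where
  "op_ideal \<B> \<I> \<longleftrightarrow> \<I> \<subseteq> \<B> \<and> 0 \<in> \<I> \<and>
     (\<forall>S\<in>\<I>. \<forall>T\<in>\<I>. S + T \<in> \<I>) \<and> (\<forall>c. \<forall>T\<in>\<I>. op_scaleC c T \<in> \<I>) \<and>
     (\<forall>S\<in>\<B>. \<forall>T\<in>\<I>. S o\<^sub>L T \<in> \<I> \<and> T o\<^sub>L S \<in> \<I>)"

text \<open>
  In the monotonicity clause \<open>S \<in> \<I>\<close> is automatic: ideals of von Neumann algebras are hereditary.
\<close>

definition normed_ideal ::
    "'a::complex_hilbert_space op set \<Rightarrow> 'a op set \<Rightarrow> ('a op \<Rightarrow> real) \<Rightarrow> bool" where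
  "normed_ideal \<B> \<I> N \<longleftrightarrow> op_ideal \<B> \<I> \<and>
     (\<forall>T\<in>\<I>. N T \<ge> 0 \<and> (N T = 0 \<longleftrightarrow> T = 0)) \<and>
     (\<forall>S\<in>\<I>. \<forall>T\<in>\<I>. N (S + T) \<le> N S + N T) \<and>
     (\<forall>c. \<forall>T\<in>\<I>. N (op_scaleC c T) = norm c * N T) \<and>
     (\<forall>S\<in>\<B>. \<forall>T\<in>\<I>. op_le 0 S \<and> op_le S T \<longrightarrow> N S \<le> N T) \<and>
     (\<exists>K>0. \<forall>T\<in>\<I>. norm T \<le> K * N T) \<and>
     (\<forall>A\<in>\<B>. \<forall>T\<in>\<I>. \<forall>C\<in>\<B>. N (A o\<^sub>L T o\<^sub>L C) \<le> norm A * N T * norm C)"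

definition ideal_trace ::
    "'a::complex_hilbert_space op set \<Rightarrow> 'a op set \<Rightarrow> ('a op \<Rightarrow> complex) \<Rightarrow> bool" where
  "ideal_trace \<B> \<I> \<tau> \<longleftrightarrow>
     (\<forall>S\<in>\<I>. \<forall>T\<in>\<I>. \<tau> (S + T) = \<tau> S + \<tau> T) \<and>
     (\<forall>c. \<forall>T\<in>\<I>. \<tau> (op_scaleC c T) = c * \<tau> T) \<and>
     (\<forall>S\<in>\<I>. \<forall>T\<in>\<B>. \<tau> (S o\<^sub>L T) = \<tau> (T o\<^sub>L S))"

definition positive_trace ::
    "'a::complex_hilbert_space op set \<Rightarrow> ('a op \<Rightarrow> complex) \<Rightarrow> bool" where
  "positive_trace \<I> \<tau> \<longleftrightarrow> (\<forall>T\<in>\<I>. op_le 0 T \<longrightarrow> \<tau> T \<in> \<real>\<^sub>\<ge>\<^sub>0)"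

definition bounded_trace ::
    "'a::complex_hilbert_space op set \<Rightarrow> ('a op \<Rightarrow> real) \<Rightarrow> ('a op \<Rightarrow> complex) \<Rightarrow> bool" where
  "bounded_trace \<I> N \<tau> \<longleftrightarrow> (\<exists>M>0. \<forall>T\<in>\<I>. norm (\<tau> T) \<le> M * N T)"

definition ideal_power ::
    "'a::complex_hilbert_space op set \<Rightarrow> 'a op set \<Rightarrow> real \<Rightarrow> 'a op set" where
  "ideal_power \<B> \<I> \<alpha> = {T \<in> \<B>. op_powr (op_abs T) (1 / \<alpha>) \<in> \<I>}"


section \<open>Complex measures\<close>

text \<open>
  A complex measure on the measurable space of \<open>M\<close> is a countably additive complex set function;
  its values off \<^term>\<open>sets M\<close> are irrelevant, and only the \<open>\<sigma>\<close>-algebra of \<open>M\<close> is used.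
\<close>

definition complex_measure :: "'b measure \<Rightarrow> ('b set \<Rightarrow> complex) \<Rightarrow> bool" where
  "complex_measure M \<mu> \<longleftrightarrow>
     (\<forall>E :: nat \<Rightarrow> 'b set. range E \<subseteq> sets M \<and> disjoint_family E
        \<longrightarrow> (\<lambda>n. \<mu> (E n)) sums \<mu> (\<Union>n. E n))"

text \<open>
  The positive variation of a signed measure \<open>\<nu>\<close>; the negative one is obtained from \<open>- \<nu>\<close>.
  Since \<open>\<nu> {} = 0\<close>, the truncation of negative numbers by \<^const>\<open>ennreal\<close> does not affect the
  supremum.
\<close>

definition positive_variation :: "'b measure \<Rightarrow> ('b set \<Rightarrow> real) \<Rightarrow> 'b measure" where
  "positive_variation M \<nu> =
     measure_of (space M) (sets M) (\<lambda>A. SUP B\<in>{B \<in> sets M. B \<subseteq> A}. ennreal (\<nu> B))"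

definition signed_integral :: "'b measure \<Rightarrow> ('b set \<Rightarrow> real) \<Rightarrow> ('b \<Rightarrow> complex) \<Rightarrow> complex" where
  "signed_integral M \<nu> f =
     integral\<^sup>L (positive_variation M \<nu>) f - integral\<^sup>L (positive_variation M (\<lambda>A. - \<nu> A)) f"

definition complex_measure_integral ::
    "'b measure \<Rightarrow> ('b set \<Rightarrow> complex) \<Rightarrow> ('b \<Rightarrow> complex) \<Rightarrow> complex" where
  "complex_measure_integral M \<mu> f =
     signed_integral M (\<lambda>A. Re (\<mu> A)) f + \<i> * signed_integral M (\<lambda>A. Im (\<mu> A)) f"


section \<open>Spectral shift measures\<close>

definition C_differentiable :: "nat \<Rightarrow> (real \<Rightarrow> complex) \<Rightarrow> bool" where
  "C_differentiable k f \<longleftrightarrow> (\<exists>g :: nat \<Rightarrow> real \<Rightarrow> complex. g 0 = f \<and>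
     (\<forall>i<k. \<forall>x. (g i has_vector_derivative g (Suc i) x) (at x)) \<and> continuous_on UNIV (g k))"

text \<open>
  Spectra are subsets of the complex plane; for self-adjoint operators they lie on the real line,
  and the hull is taken there.
\<close>

definition spectral_hull :: "'a::complex_hilbert_space op \<Rightarrow> 'a op \<Rightarrow> real set" where
  "spectral_hull H\<^sub>0 V =
     convex hull {t. complex_of_real t \<in> op_spectrum H\<^sub>0 \<union> op_spectrum (H\<^sub>0 + V)}"

abbreviation hull_borel :: "'a::complex_hilbert_space op \<Rightarrow> 'a op \<Rightarrow> real measure" where
  "hull_borel H\<^sub>0 V \<equiv> restrict_space borel (spectral_hull H\<^sub>0 V)"

definition spectral_shift_measure ::
    "('a::complex_hilbert_space op \<Rightarrow> complex) \<Rightarrow> 'a op \<Rightarrow> 'a op \<Rightarrow> (real set \<Rightarrow> complex) \<Rightarrow> bool"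
  where
  "spectral_shift_measure \<tau> H\<^sub>0 V \<mu> \<longleftrightarrow>
     complex_measure (hull_borel H\<^sub>0 V) \<mu> \<and>
     (\<forall>f. C_differentiable 3 f \<longrightarrow>
        \<tau> (cfc f (H\<^sub>0 + V) - cfc f H\<^sub>0) =
          complex_measure_integral (hull_borel H\<^sub>0 V) \<mu> (\<lambda>t. vector_derivative f (at t)))"

end

theory Submission
  imports Defs "HOL-Computational_Algebra.Fundamental_Theorem_Algebra"
begin

text \<open>
  Since \<open>H\<^sub>0 = a I\<close>, the operators \<open>f(H\<^sub>0 + V)\<close> and \<open>f(H\<^sub>0)\<close> are functions of the single self-adjoint
  operator \<open>V\<close>. For a polynomial \<open>f\<close>, Taylor expansion at \<open>a\<close> gives
  \<open>f(H\<^sub>0 + V) - f(H\<^sub>0) = f'(a) V + V\<^sup>2 r(V)\<close> with a polynomial \<open>r\<close>. The last term is a product of two elements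
  of the ideal, so the trace kills it and the spectral shift measure satisfies \<open>\<integral> f' d\<mu> = \<tau>(V) f'(a)\<close>. Every
  polynomial is such an \<open>f'\<close>, and a measure on a bounded set is determined by its moments; hence
  \<open>\<mu> = \<tau>(V) \<delta>\<^sub>a\<close>. The two halves are carried by the lemmas \<open>trace_op_poly_diff\<close> and
  \<open>signed_measure_eq_point_mass\<close>.

  The square of the ideal is given by the condition \<open>\<bar>T\<bar>\<^sup>1\<^sup>/\<^sup>2 \<in> \<I>\<close>. For \<open>W = W\<^sup>* \<in> \<I>\<close> the element \<open>W\<^sup>4\<close> meets
  it, because \<open>\<bar>W\<^sup>4\<bar>\<^sup>1\<^sup>/\<^sup>2 = W\<^sup>2\<close>. Applied to \<open>W = V s(V)\<close>, and with fourth powers spanning all polynomials, this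
  shows \<open>\<tau>(V\<^sup>4 q(V)) = 0\<close>. The functional \<open>p \<mapsto> \<tau>(V p(V))\<close> is continuous for the supremum norm on the
  spectrum, because \<open>\<tau>\<close> is bounded by the ideal norm, and \<open>t q(t)\<close> is a uniform limit of polynomials divisible
  by \<open>t\<^sup>3\<close>. Therefore already \<open>\<tau>(V\<^sup>2 q(V)) = 0\<close>.

  Both the identification of \<open>\<bar>W\<^sup>4\<bar>\<^sup>1\<^sup>/\<^sup>2\<close> and the continuity rest on the estimate
  \<open>\<parallel>p(H)\<parallel> \<le> sup \<bar>p\<bar>\<close> over the spectrum of a self-adjoint \<open>H\<close> (\<open>norm_op_poly_le\<close>), which comes from two facts:
  \<open>\<parallel>S\<parallel>\<close> or \<open>- \<parallel>S\<parallel>\<close> is in the spectrum of a self-adjoint \<open>S\<close>, and the spectrum of \<open>p(H)\<close> consists of values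
  of \<open>p\<close> on that of \<open>H\<close>.
\<close>

section \<open>The complex algebra of bounded operators\<close>

lemma scaleC_one [simp]: "1 *\<^sub>C (x::'a::complex_hilbert_space) = x"
  using scaleC_of_real[of 1 x] by simp

lemma scaleC_zero_left [simp]: "0 *\<^sub>C (x::'a::complex_hilbert_space) = 0"
  using scaleC_of_real[of 0 x] by simp

lemma scaleC_zero_right [simp]: "c *\<^sub>C (0::'a::complex_hilbert_space) = 0"
  using scaleC_add_right[of c "0::'a" 0] by simp

lemma scaleC_minus_left: "(- c) *\<^sub>C (x::'a::complex_hilbert_space) = - (c *\<^sub>C x)"
  using scaleC_add_left[of "- c" c x] by (simp add: eq_neg_iff_add_eq_0)

lemma scaleC_minus_right: "c *\<^sub>C (- x::'a::complex_hilbert_space) = - (c *\<^sub>C x)"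
  using scaleC_add_right[of c "- x" x] by (simp add: eq_neg_iff_add_eq_0)

lemma scaleC_diff_left: "(c - d) *\<^sub>C (x::'a::complex_hilbert_space) = c *\<^sub>C x - d *\<^sub>C x"
  using scaleC_add_left[of c "- d" x] by (simp add: scaleC_minus_left)

lemma scaleC_diff_right: "c *\<^sub>C (x - y::'a::complex_hilbert_space) = c *\<^sub>C x - c *\<^sub>C y"
  using scaleC_add_right[of c x "- y"] by (simp add: scaleC_minus_right)

lemma scaleC_scaleR: "c *\<^sub>C (r *\<^sub>R x::'a::complex_hilbert_space) = r *\<^sub>R (c *\<^sub>C x)"
  by (simp add: scaleC_of_real[symmetric] scaleC_scaleC mult.commute)

lemma cinner_add_right: "cinner (x::'a::complex_hilbert_space) (y + z) = cinner x y + cinner x z"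
  by (metis cinner_add_left cinner_commute complex_cnj_add)

lemma cinner_scaleC_right:
  "cinner (x::'a::complex_hilbert_space) (c *\<^sub>C y) = cnj c * cinner x y"
  by (metis cinner_commute cinner_scaleC_left complex_cnj_mult)

lemma cinner_minus_left: "cinner (- x::'a::complex_hilbert_space) y = - cinner x y"
  using cinner_scaleC_left[of "-1" x y] by (simp add: scaleC_minus_left)

lemma cinner_diff_left: "cinner (x - y::'a::complex_hilbert_space) z = cinner x z - cinner y z"
  using cinner_add_left[of x "- y" z] by (simp add: cinner_minus_left)

lemma cinner_self: "cinner (x::'a::complex_hilbert_space) x = complex_of_real ((norm x)\<^sup>2)"
proof -
  have "cinner x x \<in> \<real>"
    using cinner_commute[of x x] by (simp add: Reals_cnj_iff)
  then show ?thesis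
    using inner_eq_Re_cinner[of x x] by (simp add: power2_norm_eq_inner complex_is_Real_iff complex_eq_iff)
qed

lemma norm_scaleC: "norm (c *\<^sub>C (x::'a::complex_hilbert_space)) = norm c * norm x"
proof -
  have "complex_of_real ((norm (c *\<^sub>C x))\<^sup>2) = (c * cnj c) * cinner x x"
    unfolding cinner_self[symmetric] by (simp add: cinner_scaleC_left cinner_scaleC_right)
  also have "\<dots> = complex_of_real ((norm c * norm x)\<^sup>2)"
    unfolding complex_norm_square[symmetric] cinner_self by (simp add: power_mult_distrib)
  finally have "(norm (c *\<^sub>C x))\<^sup>2 = (norm c * norm x)\<^sup>2"
    using of_real_eq_iff by blast
  then show ?thesis by (simp add: power2_eq_iff_nonneg)
qed

lemma op_scaleC_apply [simp]: "blinfun_apply (op_scaleC c T) x = c *\<^sub>C blinfun_apply T x"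
proof -
  have "bounded_linear (\<lambda>x. c *\<^sub>C blinfun_apply T x)"
  proof (rule bounded_linear_intro[where K = "norm c * norm T"])
    show "norm (c *\<^sub>C blinfun_apply T x) \<le> norm x * (norm c * norm T)" for x
      using mult_left_mono[OF norm_blinfun[of T x], of "norm c"]
      by (simp add: norm_scaleC mult.assoc mult.left_commute mult.commute)
  qed (simp_all add: blinfun.bilinear_simps scaleC_add_right scaleC_scaleR)
  then show ?thesis
    unfolding op_scaleC_def by (simp add: bounded_linear_Blinfun_apply)
qed

lemmas op_simps = blinfun.bilinear_simps scaleC_add_left scaleC_add_right scaleC_scaleC
  scaleC_diff_left scaleC_diff_right scaleC_minus_left scaleC_minus_right

lemma op_scaleC_of_real: "op_scaleC (complex_of_real r) T = r *\<^sub>R T"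
  by (rule blinfun_eqI) (simp add: scaleC_of_real blinfun.bilinear_simps)

lemma bop_apply: "T \<in> bop \<Longrightarrow> blinfun_apply T (c *\<^sub>C x) = c *\<^sub>C blinfun_apply T x"
  by (simp add: bop_def)

lemma bop_zero [simp]: "0 \<in> bop"
  and bop_id [simp]: "id_blinfun \<in> bop"
  and bop_add: "S \<in> bop \<Longrightarrow> T \<in> bop \<Longrightarrow> S + T \<in> bop"
  and bop_diff: "S \<in> bop \<Longrightarrow> T \<in> bop \<Longrightarrow> S - T \<in> bop"
  and bop_scaleC: "T \<in> bop \<Longrightarrow> op_scaleC c T \<in> bop"
  and bop_compose: "S \<in> bop \<Longrightarrow> T \<in> bop \<Longrightarrow> S o\<^sub>L T \<in> bop"
  by (auto simp: bop_def op_simps mult.commute)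

lemma compose_assoc: "(A o\<^sub>L B) o\<^sub>L C = A o\<^sub>L (B o\<^sub>L C)"
  by (rule blinfun_eqI) simp

lemma compose_id [simp]: "A o\<^sub>L id_blinfun = A" "id_blinfun o\<^sub>L A = A"
  by (rule blinfun_eqI, simp)+


section \<open>Polynomials in an operator\<close>

lemma op_poly_0 [simp]: "op_poly 0 T = 0"
  by (simp add: op_poly_def) (rule blinfun_eqI, simp)

text \<open>Horner's rule, which turns inductions over polynomials into inductions over operators.\<close>

lemma op_poly_pCons: "op_poly (pCons c p) T = op_scaleC c id_blinfun + (T o\<^sub>L op_poly p T)"
  if "T \<in> bop"
proof (cases "p = 0")
  case True
  show ?thesis
    by (cases "c = 0") (auto simp: True op_poly_def intro!: blinfun_eqI)
next
  case False
  have "op_poly (pCons c p) T =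
      op_scaleC c id_blinfun + (\<Sum>i\<le>degree p. op_scaleC (coeff p i) (((o\<^sub>L) T ^^ Suc i) id_blinfun))"
    using False by (simp add: op_poly_def sum.atMost_Suc_shift del: sum.atMost_Suc)
  also have "(\<Sum>i\<le>degree p. op_scaleC (coeff p i) (((o\<^sub>L) T ^^ Suc i) id_blinfun))
      = T o\<^sub>L op_poly p T"
    unfolding op_poly_def
    by (rule blinfun_eqI) (simp add: blinfun.sum_left blinfun.sum_right bop_apply[OF that])
  finally show ?thesis .
qed

lemma op_poly_in_bop: "op_poly p T \<in> bop" if "T \<in> bop"
  by (induction p) (auto simp: op_poly_pCons[OF that] that intro!: bop_add bop_scaleC bop_compose)

lemma op_poly_const: "op_poly [:c:] T = op_scaleC c id_blinfun" if "T \<in> bop"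
  by (simp add: op_poly_pCons[OF that])

lemma op_poly_X: "op_poly [:c, 1:] T = T + op_scaleC c id_blinfun" if "T \<in> bop"
  by (rule blinfun_eqI) (simp add: op_poly_pCons[OF that] blinfun.bilinear_simps)

lemma op_poly_identity: "op_poly [:0, 1:] T = T" if "T \<in> bop"
  using op_scaleC_of_real[of 0 "id_blinfun :: 'a op"] by (simp add: op_poly_X[OF that])

lemma op_poly_add: "op_poly (p + q) T = op_poly p T + op_poly q T" if "T \<in> bop"
proof (induction p arbitrary: q)
  case (pCons c p)
  obtain d r where q: "q = pCons d r" by (cases q)
  show ?case
    by (rule blinfun_eqI) (simp add: q op_poly_pCons[OF that] pCons.IH op_simps)
qed simp

lemma op_poly_smult: "op_poly (smult c p) T = op_scaleC c (op_poly p T)" if "T \<in> bop"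
  by (induction p)
    (auto simp: op_poly_pCons[OF that] op_simps bop_apply[OF that] intro!: blinfun_eqI)

lemma op_poly_diff: "op_poly (p - q) T = op_poly p T - op_poly q T" if "T \<in> bop"
proof -
  have "p - q = p + smult (-1) q" by simp
  then show ?thesis
    by (simp only: op_poly_add[OF that] op_poly_smult[OF that])
      (rule blinfun_eqI, simp add: op_simps)
qed

lemma op_poly_mult: "op_poly (p * q) T = op_poly p T o\<^sub>L op_poly q T" if "T \<in> bop"
proof (induction p)
  case (pCons c p)
  show ?case
    by (rule blinfun_eqI)
      (simp add: op_poly_pCons[OF that] op_poly_add[OF that] op_poly_smult[OF that] pCons.IH
        mult_pCons_left op_simps)
qed (rule blinfun_eqI, simp)

lemma op_poly_pcompose: "op_poly (pcompose p q) T = op_poly p (op_poly q T)" if "T \<in> bop"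
  by (induction p)
    (simp_all add: pcompose_pCons op_poly_add[OF that] op_poly_mult[OF that] op_poly_const[OF that]
      op_poly_pCons[OF op_poly_in_bop[OF that]])


section \<open>Self-adjoint operators and invertibility\<close>

lemma adjoint_unique: "S = T" if "is_adjoint S R" "is_adjoint T R"
proof (rule blinfun_eqI)
  fix x
  have "cinner (blinfun_apply S x - blinfun_apply T x) y = 0" for y
    using that by (simp add: is_adjoint_def cinner_diff_left)
  then show "blinfun_apply S x = blinfun_apply T x"
    using cinner_self[of "blinfun_apply S x - blinfun_apply T x"] by simp
qed

lemma adj_selfadjoint: "adj T = T" if "selfadjoint T"
  unfolding adj_def using that by (auto simp: selfadjoint_def intro: adjoint_unique)

lemma is_adjoint_op_poly:
  assumes "selfadjoint H"
  shows "is_adjoint (op_poly (map_poly cnj p) H) (op_poly p H)"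
proof (induction p)
  case (pCons c p)
  have H: "H \<in> bop" "\<And>x y. cinner (blinfun_apply H x) y = cinner x (blinfun_apply H y)"
    using assms by (auto simp: selfadjoint_def is_adjoint_def)
  have commute: "H o\<^sub>L op_poly q H = op_poly q H o\<^sub>L H" for q
    using op_poly_mult[OF H(1), of "[:0,1:]" q] op_poly_mult[OF H(1), of q "[:0,1:]"]
    by (simp add: op_poly_identity[OF H(1)] mult.commute)
  have commute_apply: "blinfun_apply H (blinfun_apply (op_poly q H) x) =
      blinfun_apply (op_poly q H) (blinfun_apply H x)" for q x
    using arg_cong[OF commute[of q], of "\<lambda>T. blinfun_apply T x"] by simp
  from pCons.IH show ?case
    by (simp add: is_adjoint_def map_poly_pCons op_poly_pCons[OF H(1)] blinfun.bilinear_simps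
        cinner_add_left cinner_add_right cinner_scaleC_left cinner_scaleC_right H(2) commute_apply)
qed (simp add: is_adjoint_def cinner_self[of 0, simplified] cinner_minus_left
      cinner_scaleC_left[of 0, simplified] cinner_scaleC_right[of _ 0, simplified])

definition real_coeffs :: "complex poly \<Rightarrow> bool" where
  "real_coeffs p \<longleftrightarrow> (\<forall>i. coeff p i \<in> \<real>)"

lemma real_coeffs_add: "real_coeffs p \<Longrightarrow> real_coeffs q \<Longrightarrow> real_coeffs (p + q)"
  and real_coeffs_diff: "real_coeffs p \<Longrightarrow> real_coeffs q \<Longrightarrow> real_coeffs (p - q)"
  and real_coeffs_mult: "real_coeffs p \<Longrightarrow> real_coeffs q \<Longrightarrow> real_coeffs (p * q)"
  by (auto simp: real_coeffs_def coeff_mult intro!: sum_in_Reals)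

lemma real_coeffs_pCons: "real_coeffs (pCons c p) \<longleftrightarrow> c \<in> \<real> \<and> real_coeffs p"
  by (auto simp: real_coeffs_def coeff_pCons split: nat.splits)

lemma real_coeffs_0 [simp]: "real_coeffs 0"
  by (simp add: real_coeffs_def)

lemma real_coeffs_power: "real_coeffs p \<Longrightarrow> real_coeffs (p ^ n)"
  by (induction n) (auto simp: real_coeffs_mult real_coeffs_pCons one_pCons)

lemma selfadjoint_op_poly: "selfadjoint (op_poly p H)" if "selfadjoint H" "real_coeffs p"
proof -
  have "map_poly cnj p = p"
    using that(2) by (auto simp: real_coeffs_def poly_eq_iff coeff_map_poly Reals_cnj_iff)
  then show ?thesis
    using is_adjoint_op_poly[OF that(1), of p] that op_poly_in_bop
    by (auto simp: selfadjoint_def)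
qed

definition bop_invertible :: "'a::complex_hilbert_space op \<Rightarrow> bool" where
  "bop_invertible T \<longleftrightarrow> (\<exists>S\<in>bop. S o\<^sub>L T = id_blinfun \<and> T o\<^sub>L S = id_blinfun)"

lemma mem_op_spectrum: "z \<in> op_spectrum T \<longleftrightarrow> \<not> bop_invertible (T - op_scaleC z id_blinfun)"
  by (simp add: op_spectrum_def bop_invertible_def)

lemma bop_invertible_compose:
  assumes "bop_invertible S" "bop_invertible T"
  shows "bop_invertible (S o\<^sub>L T)"
proof -
  obtain S' where S': "S' \<in> bop" "S' o\<^sub>L S = id_blinfun" "S o\<^sub>L S' = id_blinfun"
    using assms(1) by (auto simp: bop_invertible_def)
  obtain T' where T': "T' \<in> bop" "T' o\<^sub>L T = id_blinfun" "T o\<^sub>L T' = id_blinfun"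
    using assms(2) by (auto simp: bop_invertible_def)
  have "(T' o\<^sub>L S') o\<^sub>L (S o\<^sub>L T) = T' o\<^sub>L (S' o\<^sub>L S) o\<^sub>L T"
    "(S o\<^sub>L T) o\<^sub>L (T' o\<^sub>L S') = S o\<^sub>L (T o\<^sub>L T') o\<^sub>L S'"
    by (simp_all only: compose_assoc)
  then have "(T' o\<^sub>L S') o\<^sub>L (S o\<^sub>L T) = id_blinfun" "(S o\<^sub>L T) o\<^sub>L (T' o\<^sub>L S') = id_blinfun"
    by (simp_all only: S' T' compose_id)
  then show ?thesis
    unfolding bop_invertible_def using bop_compose[OF T'(1) S'(1)] by blast
qed

lemma bop_invertible_bounded_below:
  assumes "bop_invertible T"
  obtains c where "c > 0" "\<And>x. c * norm x \<le> norm (blinfun_apply T x)"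
proof -
  obtain S where S: "S o\<^sub>L T = id_blinfun"
    using assms by (auto simp: bop_invertible_def)
  have "norm x \<le> (norm S + 1) * norm (blinfun_apply T x)" for x
  proof -
    have "blinfun_apply S (blinfun_apply T x) = x"
      using arg_cong[OF S, of "\<lambda>R. blinfun_apply R x"] by simp
    then have "norm x \<le> norm S * norm (blinfun_apply T x)"
      using norm_blinfun[of S "blinfun_apply T x"] by simp
    then show ?thesis using norm_ge_zero[of "blinfun_apply T x"] by (simp only: distrib_right)
  qed
  moreover have "norm S + 1 > 0"
    by (simp add: add_nonneg_pos)
  ultimately show thesis
    by (intro that[of "1 / (norm S + 1)"]) (simp_all add: pos_divide_le_eq mult.commute)
qed

text \<open>
  The Lax-Milgram argument: for small positive \<open>\<rho>\<close> the map \<open>x \<mapsto> x - \<rho> (w T x - y)\<close> is a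
  contraction, and its fixed point solves \<open>w T x = y\<close>. The factor \<open>w\<close> serves to rotate the numerical range of
  \<open>T\<close> into the right half plane.
\<close>

lemma coercive_invertible:
  fixes T :: "'a::complex_hilbert_space op"
  assumes T: "T \<in> bop" and c: "c > 0"
    and coercive: "\<And>x. c * (norm x)\<^sup>2 \<le> Re (w * cinner (blinfun_apply T x) x)"
  shows "bop_invertible T"
proof -
  define A where "A = op_scaleC w T"
  have A: "c * (norm x)\<^sup>2 \<le> inner (blinfun_apply A x) x" for x
    using coercive[of x] by (simp add: A_def inner_eq_Re_cinner cinner_scaleC_left)
  have below: "c * norm x \<le> norm (blinfun_apply A x)" for x
  proof (cases "x = 0")
    case False
    have "c * (norm x)\<^sup>2 \<le> norm (blinfun_apply A x) * norm x"
      using A[of x] norm_cauchy_schwarz[of "blinfun_apply A x" x] by linarith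
    then show ?thesis using False by (simp add: power2_eq_square)
  qed simp
  define K where "K = norm A + c"
  have K: "K > 0" "c \<le> K" "norm A \<le> K" using c by (auto simp: K_def add_nonneg_pos)
  define \<rho> where "\<rho> = c / K\<^sup>2"
  have \<rho>: "\<rho> > 0" using c K by (simp add: \<rho>_def)
  define k where "k = sqrt (1 - c\<^sup>2 / K\<^sup>2)"
  have "c\<^sup>2 / K\<^sup>2 \<le> 1" using c K by (simp add: power_mono)
  then have k: "0 \<le> k" "k < 1" "k\<^sup>2 = 1 - c\<^sup>2 / K\<^sup>2"
    using c K by (auto simp: k_def)
  have contr: "norm (x - \<rho> *\<^sub>R blinfun_apply A x) \<le> k * norm x" for x
  proof -
    have "(norm (x - \<rho> *\<^sub>R blinfun_apply A x))\<^sup>2 =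
        (norm x)\<^sup>2 - 2 * \<rho> * inner (blinfun_apply A x) x + \<rho>\<^sup>2 * (norm (blinfun_apply A x))\<^sup>2"
      unfolding power2_norm_eq_inner
      by (simp add: inner_diff_left inner_diff_right inner_commute algebra_simps power2_eq_square)
    also have "\<dots> \<le> (norm x)\<^sup>2 - 2 * \<rho> * (c * (norm x)\<^sup>2) + \<rho>\<^sup>2 * (K * norm x)\<^sup>2"
    proof -
      have "norm (blinfun_apply A x) \<le> K * norm x"
        using norm_blinfun[of A x] mult_right_mono[OF K(3), of "norm x"] by simp
      then have "\<rho>\<^sup>2 * (norm (blinfun_apply A x))\<^sup>2 \<le> \<rho>\<^sup>2 * (K * norm x)\<^sup>2"
        by (intro mult_left_mono power_mono) auto
      moreover have "2 * \<rho> * (c * (norm x)\<^sup>2) \<le> 2 * \<rho> * inner (blinfun_apply A x) x"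
        using A[of x] \<rho> by (intro mult_left_mono) auto
      ultimately show ?thesis by linarith
    qed
    also have "\<dots> = (1 - c\<^sup>2 / K\<^sup>2) * (norm x)\<^sup>2"
      using K(1) by (simp add: \<rho>_def field_simps power2_eq_square)
    also have "\<dots> = (k * norm x)\<^sup>2"
      by (simp add: k(3) power_mult_distrib)
    finally show ?thesis using k(1) by (simp add: abs_le_square_iff[symmetric])
  qed
  have surj: "\<exists>x. blinfun_apply A x = y" for y
  proof -
    have "\<exists>!x. x - \<rho> *\<^sub>R (blinfun_apply A x - y) = x"
    proof (rule banach_fix_type[OF k(1,2)], intro allI)
      fix u v
      have "u - \<rho> *\<^sub>R (blinfun_apply A u - y) - (v - \<rho> *\<^sub>R (blinfun_apply A v - y))
          = (u - v) - \<rho> *\<^sub>R blinfun_apply A (u - v)"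
        by (simp add: blinfun.bilinear_simps algebra_simps)
      then show "dist (u - \<rho> *\<^sub>R (blinfun_apply A u - y)) (v - \<rho> *\<^sub>R (blinfun_apply A v - y))
          \<le> k * dist u v"
        using contr[of "u - v"] by (simp only: dist_norm)
    qed
    then obtain x where "x - \<rho> *\<^sub>R (blinfun_apply A x - y) = x" by blast
    then show ?thesis using \<rho> by auto
  qed
  have inj: "x = y" if "blinfun_apply A x = blinfun_apply A y" for x y
    using below[of "x - y"] that c by (simp add: blinfun.bilinear_simps mult_le_0_iff)
  define g where "g y = (THE x. blinfun_apply A x = y)" for y
  have Ag: "blinfun_apply A (g y) = y" for y
    unfolding g_def by (rule theI') (use surj inj in blast)
  have gA: "g (blinfun_apply A x) = x" for x
    using Ag inj by blast
  have A_bop: "A \<in> bop" using T by (simp add: A_def bop_scaleC)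
  have "bounded_linear g"
  proof (rule bounded_linear_intro[where K = "1 / c"])
    show "g (x + y) = g x + g y" for x y
      by (rule inj) (simp add: Ag blinfun.bilinear_simps)
    show "g (r *\<^sub>R x) = r *\<^sub>R g x" for r x
      by (rule inj) (simp add: Ag blinfun.bilinear_simps)
    show "norm (g x) \<le> norm x * (1 / c)" for x
      using below[of "g x"] c by (simp add: Ag field_simps)
  qed
  then obtain G where G: "\<And>x. blinfun_apply G x = g x"
    using bounded_linear_Blinfun_apply by metis
  have "g (d *\<^sub>C x) = d *\<^sub>C g x" for d x
    by (rule inj) (simp add: Ag bop_apply[OF A_bop])
  then have "G \<in> bop" by (simp add: bop_def G)
  moreover have "op_scaleC w G o\<^sub>L T = id_blinfun"
  proof (rule blinfun_eqI)
    fix x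
    show "blinfun_apply (op_scaleC w G o\<^sub>L T) x = blinfun_apply id_blinfun x"
      using gA[of x] by (simp add: G A_def \<open>\<And>d x. g (d *\<^sub>C x) = d *\<^sub>C g x\<close>)
  qed
  moreover have "T o\<^sub>L op_scaleC w G = id_blinfun"
  proof (rule blinfun_eqI)
    fix x
    show "blinfun_apply (T o\<^sub>L op_scaleC w G) x = blinfun_apply id_blinfun x"
      using Ag[of x] by (simp add: G A_def bop_apply[OF T])
  qed
  ultimately show ?thesis
    unfolding bop_invertible_def using bop_scaleC by blast
qed


section \<open>The spectrum of a self-adjoint operator\<close>

lemma selfadjoint_in_bop: "selfadjoint H \<Longrightarrow> H \<in> bop"
  by (simp add: selfadjoint_def)

lemma selfadjoint_cinner:
  "selfadjoint H \<Longrightarrow> cinner (blinfun_apply H x) y = cinner x (blinfun_apply H y)"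
  by (simp add: selfadjoint_def is_adjoint_def)

lemma selfadjoint_quadratic_form:
  assumes "selfadjoint H"
  shows "cinner (blinfun_apply H x) x = complex_of_real (inner (blinfun_apply H x) x)"
proof -
  have "cinner (blinfun_apply H x) x \<in> \<real>"
    using cinner_commute[of "blinfun_apply H x" x] selfadjoint_cinner[OF assms, of x x]
    by (simp add: Reals_cnj_iff)
  then show ?thesis
    by (simp add: inner_eq_Re_cinner)
qed

lemma selfadjoint_spectrum_real:
  assumes "selfadjoint H" and z: "z \<in> op_spectrum H"
  shows "z = complex_of_real (Re z)"
proof -
  have "Im z = 0"
  proof (rule ccontr)
    assume "Im z \<noteq> 0"
    have "bop_invertible (H - op_scaleC z id_blinfun)"
    proof (rule coercive_invertible)
      show "H - op_scaleC z id_blinfun \<in> bop"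
        by (intro bop_diff bop_scaleC bop_id selfadjoint_in_bop assms)
      show "(Im z)\<^sup>2 > 0" using \<open>Im z \<noteq> 0\<close> by simp
      \<comment> \<open>The quadratic form of \<open>H\<close> is real, so only \<open>- z\<close> contributes after multiplication by \<open>\<i> Im z\<close>.\<close>
      show "(Im z)\<^sup>2 * (norm x)\<^sup>2
          \<le> Re ((\<i> * complex_of_real (Im z)) *
              cinner (blinfun_apply (H - op_scaleC z id_blinfun) x) x)" for x
        by (simp add: blinfun.bilinear_simps cinner_diff_left cinner_scaleC_left cinner_self
            selfadjoint_quadratic_form[OF assms(1)] power2_eq_square)
    qed
    then show False using z by (simp add: mem_op_spectrum)
  qed
  then show ?thesis by (simp add: complex_eq_iff)
qed

lemma selfadjoint_spectrum_bounded:
  assumes "selfadjoint H" and t: "complex_of_real t \<in> op_spectrum H"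
  shows "\<bar>t\<bar> \<le> norm H"
proof (rule ccontr)
  assume less: "\<not> \<bar>t\<bar> \<le> norm H"
  have "bop_invertible (H - op_scaleC (complex_of_real t) id_blinfun)"
  proof (rule coercive_invertible)
    show "H - op_scaleC (complex_of_real t) id_blinfun \<in> bop"
      by (intro bop_diff bop_scaleC bop_id selfadjoint_in_bop assms)
    show "\<bar>t\<bar> - norm H > 0" using less by simp
    show "(\<bar>t\<bar> - norm H) * (norm x)\<^sup>2 \<le> Re (complex_of_real (- sgn t) *
        cinner (blinfun_apply (H - op_scaleC (complex_of_real t) id_blinfun) x) x)" for x
    proof -
      have "\<bar>inner (blinfun_apply H x) x\<bar> \<le> norm H * (norm x)\<^sup>2"
        using Cauchy_Schwarz_ineq2[of "blinfun_apply H x" x]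
          mult_right_mono[OF norm_blinfun[of H x], of "norm x"]
        by (simp add: power2_eq_square mult.assoc)
      moreover have "t \<noteq> 0" using less by auto
      ultimately show ?thesis
        by (auto simp: blinfun.bilinear_simps cinner_diff_left cinner_scaleC_left cinner_self
            selfadjoint_quadratic_form[OF assms(1)] sgn_if algebra_simps abs_if split: if_splits)
    qed
  qed
  then show False using t by (simp add: mem_op_spectrum)
qed

lemma selfadjoint_square_spectrum_nonneg:
  assumes "selfadjoint B" and t: "complex_of_real t \<in> op_spectrum (B o\<^sub>L B)"
  shows "t \<ge> 0"
proof (rule ccontr)
  assume less: "\<not> t \<ge> 0"
  have "bop_invertible ((B o\<^sub>L B) - op_scaleC (complex_of_real t) id_blinfun)"
  proof (rule coercive_invertible)
    show "(B o\<^sub>L B) - op_scaleC (complex_of_real t) id_blinfun \<in> bop"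
      by (intro bop_diff bop_compose bop_scaleC bop_id selfadjoint_in_bop assms)
    show "- t > 0" using less by simp
    show "- t * (norm x)\<^sup>2 \<le> Re (1 *
        cinner (blinfun_apply ((B o\<^sub>L B) - op_scaleC (complex_of_real t) id_blinfun) x) x)" for x
      by (simp add: blinfun.bilinear_simps cinner_diff_left cinner_scaleC_left cinner_self
          selfadjoint_cinner[OF assms(1)])
  qed
  then show False using t by (simp add: mem_op_spectrum)
qed

text \<open>
  With \<open>m = \<parallel>S\<parallel>\<close>, every \<open>x\<close> satisfies \<open>\<parallel>S\<^sup>2 x - m\<^sup>2 x\<parallel>\<^sup>2 \<le> m\<^sup>2 (m\<^sup>2 \<parallel>x\<parallel>\<^sup>2 - \<parallel>S x\<parallel>\<^sup>2)\<close>. Unit vectors that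
  almost attain the norm therefore show that \<open>S\<^sup>2 - m\<^sup>2 = (S - m) (S + m)\<close> is not bounded below.
\<close>

lemma selfadjoint_norm_in_spectrum:
  fixes S :: "'a::complex_hilbert_space op"
  assumes S: "selfadjoint S" and nontrivial: "\<exists>x::'a. x \<noteq> 0"
  shows "complex_of_real (norm S) \<in> op_spectrum S \<or> complex_of_real (- norm S) \<in> op_spectrum S"
proof (rule ccontr)
  assume neg: "\<not> ?thesis"
  define m where "m = norm S"
  have "bop_invertible ((S - op_scaleC (complex_of_real m) id_blinfun) o\<^sub>L
      (S - op_scaleC (complex_of_real (- m)) id_blinfun))"
    by (rule bop_invertible_compose) (use neg in \<open>simp_all add: mem_op_spectrum m_def\<close>)
  also have "(S - op_scaleC (complex_of_real m) id_blinfun) o\<^sub>L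
      (S - op_scaleC (complex_of_real (- m)) id_blinfun) = (S o\<^sub>L S) - (m\<^sup>2) *\<^sub>R id_blinfun"
    by (rule blinfun_eqI)
      (simp only: op_scaleC_of_real, simp add: blinfun.bilinear_simps power2_eq_square scaleR_diff_right)
  finally obtain c where c: "c > 0"
    "\<And>x. c * norm x \<le> norm (blinfun_apply ((S o\<^sub>L S) - (m\<^sup>2) *\<^sub>R id_blinfun) x)"
    by (rule bop_invertible_bounded_below) blast
  have key: "c\<^sup>2 * (norm x)\<^sup>2 \<le> m\<^sup>2 * (m\<^sup>2 * (norm x)\<^sup>2 - (norm (blinfun_apply S x))\<^sup>2)" for x
  proof -
    let ?y = "blinfun_apply S x"
    have "inner (blinfun_apply S ?y) x = (norm ?y)\<^sup>2"
      by (simp add: inner_eq_Re_cinner selfadjoint_cinner[OF S] cinner_self)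
    then have "(norm (blinfun_apply S ?y - m\<^sup>2 *\<^sub>R x))\<^sup>2
        = (norm (blinfun_apply S ?y))\<^sup>2 - 2 * m\<^sup>2 * (norm ?y)\<^sup>2 + (m\<^sup>2)\<^sup>2 * (norm x)\<^sup>2"
      unfolding power2_norm_eq_inner
      by (simp add: inner_diff_left inner_diff_right inner_commute algebra_simps power2_eq_square)
    moreover have "(norm (blinfun_apply S ?y))\<^sup>2 \<le> (m * norm ?y)\<^sup>2"
      unfolding m_def by (intro power_mono norm_blinfun norm_ge_zero)
    moreover have "(c * norm x)\<^sup>2 \<le> (norm (blinfun_apply S ?y - m\<^sup>2 *\<^sub>R x))\<^sup>2"
      using c(2)[of x] c(1) by (intro power_mono) (simp_all add: blinfun.bilinear_simps)
    ultimately show ?thesis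
      by (simp add: power_mult_distrib algebra_simps power2_eq_square)
  qed
  obtain x0 :: 'a where x0: "x0 \<noteq> 0" using nontrivial by blast
  have m: "m > 0"
  proof (rule ccontr)
    assume "\<not> m > 0"
    then have "m = 0" by (simp add: m_def)
    then have "c\<^sup>2 * (norm x0)\<^sup>2 \<le> 0" using key[of x0] by simp
    then show False using c(1) x0 by (simp add: mult_le_0_iff)
  qed
  define b where "b = m\<^sup>2 - c\<^sup>2 / m\<^sup>2"
  have b: "(norm (blinfun_apply S x))\<^sup>2 \<le> b * (norm x)\<^sup>2" for x
    using key[of x] m by (simp add: b_def field_simps power2_eq_square)
  have "0 \<le> b * (norm x0)\<^sup>2" using b[of x0] by (rule order_trans[rotated]) simp
  then have b0: "b \<ge> 0" using x0 by (simp add: zero_le_mult_iff)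
  have "norm S \<le> sqrt b"
  proof (rule norm_blinfun_bound)
    show "norm (blinfun_apply S x) \<le> sqrt b * norm x" for x
      using real_le_rsqrt[OF b[of x]] by (simp add: real_sqrt_mult)
  qed (use b0 in simp)
  then have "m\<^sup>2 \<le> b"
    using m b0 unfolding m_def by (metis norm_ge_zero power_mono real_sqrt_pow2)
  then show False using m c(1) by (simp add: b_def field_simps)
qed

lemma bop_invertible_scalar: "c \<noteq> 0 \<Longrightarrow> bop_invertible (op_scaleC c id_blinfun)"
  unfolding bop_invertible_def
  by (rule bexI[of _ "op_scaleC (1 / c) id_blinfun"])
    (auto intro!: blinfun_eqI bop_scaleC simp: scaleC_scaleC)

text \<open>
  The harder half of the spectral mapping theorem: \<open>q(H)\<close> is a product of factors \<open>H - w\<close> with \<open>w\<close> a root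
  of \<open>q\<close>, and a nonzero scalar.
\<close>

lemma op_poly_invertible:
  assumes H: "H \<in> bop" and "q \<noteq> 0" and "\<And>w. w \<in> op_spectrum H \<Longrightarrow> poly q w \<noteq> 0"
  shows "bop_invertible (op_poly q H)"
  using assms(2,3)
proof (induction "degree q" arbitrary: q rule: less_induct)
  case less
  show ?case
  proof (cases "degree q = 0")
    case True
    then obtain c where "q = [:c:]" by (rule degree_eq_zeroE)
    then show ?thesis
      using less.prems(1) bop_invertible_scalar by (simp add: op_poly_const[OF H])
  next
    case False
    then obtain w where w: "poly q w = 0"
      using fundamental_theorem_of_algebra[of q] by (auto simp: constant_degree)
    then obtain q' where q: "q = [:- w, 1:] * q'"
      using poly_eq_0_iff_dvd by blast
    then have "q' \<noteq> 0" using less.prems(1) by auto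
    then have "degree q = Suc (degree q')"
      unfolding q by (subst degree_mult_eq) auto
    moreover have "poly q' v \<noteq> 0" if "v \<in> op_spectrum H" for v
      using less.prems(2)[OF that] by (auto simp: q)
    ultimately have "bop_invertible (op_poly q' H)"
      using less.hyps[of q'] \<open>q' \<noteq> 0\<close> by simp
    moreover have "op_poly [:- w, 1:] H = H - op_scaleC w id_blinfun"
      unfolding op_poly_X[OF H] by (rule blinfun_eqI) (simp add: op_simps)
    moreover have "w \<notin> op_spectrum H"
      using less.prems(2) w by blast
    ultimately show ?thesis
      unfolding q op_poly_mult[OF H] by (intro bop_invertible_compose) (simp_all add: mem_op_spectrum)
  qed
qed

lemma op_poly_spectrum:
  fixes H :: "'a::complex_hilbert_space op"
  assumes H: "selfadjoint H" and nontrivial: "\<exists>x::'a. x \<noteq> 0"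
    and z: "z \<in> op_spectrum (op_poly p H)"
  obtains w where "w \<in> op_spectrum H" "poly p w = z"
proof -
  have H': "H \<in> bop" by (rule selfadjoint_in_bop[OF H])
  have "\<exists>w\<in>op_spectrum H. poly p w = z"
  proof (cases "p = [:z:]")
    case True
    then show ?thesis
      using selfadjoint_norm_in_spectrum[OF H nontrivial] by auto
  next
    case False
    have "op_poly (p - [:z:]) H = op_poly p H - op_scaleC z id_blinfun"
      by (simp only: op_poly_diff[OF H'] op_poly_const[OF H'])
    then have "\<not> bop_invertible (op_poly (p - [:z:]) H)"
      using z by (simp add: mem_op_spectrum)
    then have "\<exists>w\<in>op_spectrum H. poly (p - [:z:]) w = 0"
      using op_poly_invertible[OF H', of "p - [:z:]"] False by (metis eq_iff_diff_eq_0)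
    then show ?thesis by simp
  qed
  then show thesis using that by blast
qed

text \<open>
  The estimate behind the functional calculus, via \<open>\<parallel>r(H)\<parallel>\<^sup>2 \<le> \<parallel>r(H)\<^sup>* r(H)\<parallel>\<close>: up to sign, the norm
  of the self-adjoint operator on the right is a value of \<open>\<bar>r\<bar>\<^sup>2\<close> on the spectrum of \<open>H\<close>.
\<close>

lemma norm_op_poly_le:
  fixes H :: "'a::complex_hilbert_space op"
  assumes H: "selfadjoint H" and c: "c \<ge> 0"
    and bound: "\<And>t. complex_of_real t \<in> op_spectrum H \<Longrightarrow> norm (poly r (complex_of_real t)) \<le> c"
  shows "norm (op_poly r H) \<le> c"
proof (cases "\<exists>x::'a. x \<noteq> 0")
  case False
  then have "op_poly r H = 0" by (intro blinfun_eqI) metis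
  then show ?thesis using c by simp
next
  case True
  define A where "A = op_poly r H"
  define A' where "A' = op_poly (map_poly cnj r) H"
  define S where "S = A' o\<^sub>L A"
  have H': "H \<in> bop" by (rule selfadjoint_in_bop[OF H])
  have adj1: "cinner (blinfun_apply A' x) y = cinner x (blinfun_apply A y)" for x y
    using is_adjoint_op_poly[OF H, of r] by (simp add: A_def A'_def is_adjoint_def)
  have adj2: "cinner (blinfun_apply A x) y = cinner x (blinfun_apply A' y)" for x y
    using adj1[of y x] cinner_commute by metis
  have S: "selfadjoint S"
    unfolding selfadjoint_def is_adjoint_def S_def
    using op_poly_in_bop[OF H'] by (simp add: adj1 adj2 bop_compose) (simp add: A_def A'_def bop_compose)
  have S_poly: "S = op_poly (map_poly cnj r * r) H"
    by (simp add: S_def A_def A'_def op_poly_mult[OF H'])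
  obtain s where s: "complex_of_real s \<in> op_spectrum S" "\<bar>s\<bar> = norm S"
    using selfadjoint_norm_in_spectrum[OF S True] by (metis abs_minus_cancel abs_norm_cancel)
  obtain w where w: "w \<in> op_spectrum H" "poly (map_poly cnj r * r) w = complex_of_real s"
    using op_poly_spectrum[OF H True] s(1) unfolding S_poly by blast
  obtain t where t: "w = complex_of_real t"
    using selfadjoint_spectrum_real[OF H w(1)] by blast
  have "norm S = norm (poly (map_poly cnj r * r) w)"
    using w(2) s(2) by simp
  also have "\<dots> = (norm (poly r w))\<^sup>2"
    by (simp add: t norm_mult power2_eq_square)
  also have "\<dots> \<le> c\<^sup>2"
    using bound[of t] w(1) by (simp add: t power_mono)
  finally have S_le: "norm S \<le> c\<^sup>2" .
  have "norm A \<le> c"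
  proof (rule norm_blinfun_bound[OF c])
    fix x
    have "(norm (blinfun_apply A x))\<^sup>2 = inner (blinfun_apply S x) x"
      by (simp add: S_def inner_eq_Re_cinner adj1 cinner_self)
    also have "\<dots> \<le> norm S * norm x * norm x"
      by (rule order_trans[OF norm_cauchy_schwarz mult_right_mono[OF norm_blinfun norm_ge_zero]])
    also have "\<dots> \<le> (c * norm x)\<^sup>2"
      using mult_right_mono[OF S_le, of "norm x * norm x"]
      by (simp add: power_mult_distrib power2_eq_square mult.assoc mult.left_commute)
    finally show "norm (blinfun_apply A x) \<le> c * norm x"
      by (rule power2_le_imp_le) (simp add: c)
  qed
  then show ?thesis by (simp add: A_def)
qed

text \<open>The other half of the spectral mapping theorem, for the square.\<close>

lemma spectrum_square:
  assumes "B \<in> bop" and t: "complex_of_real t \<in> op_spectrum B"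
  shows "complex_of_real (t\<^sup>2) \<in> op_spectrum (B o\<^sub>L B)"
proof (rule ccontr)
  assume "\<not> ?thesis"
  then obtain U where U: "U \<in> bop"
    "U o\<^sub>L ((B o\<^sub>L B) - op_scaleC (complex_of_real (t\<^sup>2)) id_blinfun) = id_blinfun"
    "((B o\<^sub>L B) - op_scaleC (complex_of_real (t\<^sup>2)) id_blinfun) o\<^sub>L U = id_blinfun"
    by (auto simp: mem_op_spectrum bop_invertible_def)
  define S where "S = B - op_scaleC (complex_of_real t) id_blinfun"
  define T where "T = B + op_scaleC (complex_of_real t) id_blinfun"
  have ST: "(B o\<^sub>L B) - op_scaleC (complex_of_real (t\<^sup>2)) id_blinfun = S o\<^sub>L T"
    and TS: "(B o\<^sub>L B) - op_scaleC (complex_of_real (t\<^sup>2)) id_blinfun = T o\<^sub>L S"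
    unfolding S_def T_def op_scaleC_of_real
    by (rule blinfun_eqI, simp add: blinfun.bilinear_simps power2_eq_square scaleR_diff_right
        scaleR_add_right)+
  have right: "S o\<^sub>L (T o\<^sub>L U) = id_blinfun"
    using U(3) unfolding ST compose_assoc .
  have left: "(U o\<^sub>L T) o\<^sub>L S = id_blinfun"
    using U(2) unfolding TS compose_assoc .
  have "U o\<^sub>L T = ((U o\<^sub>L T) o\<^sub>L S) o\<^sub>L (T o\<^sub>L U)"
    by (simp only: compose_assoc[of "U o\<^sub>L T" S] right compose_id)
  then have "U o\<^sub>L T = T o\<^sub>L U"
    by (simp only: left compose_id)
  then have "bop_invertible S"
    unfolding bop_invertible_def using left right
    by (intro bexI[of _ "T o\<^sub>L U"]) (auto simp: T_def assms(1) U(1) intro!: bop_compose bop_add bop_scaleC)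
  then show False using t by (simp add: mem_op_spectrum S_def)
qed


section \<open>The continuous functional calculus\<close>

lemma Weierstrass_complex_poly:
  fixes f :: "real \<Rightarrow> real"
  assumes "continuous_on {l..u} f" "e > 0"
  obtains p where "real_coeffs p"
    "\<And>t. t \<in> {l..u} \<Longrightarrow> norm (poly p (complex_of_real t) - complex_of_real (f t)) < e"
proof -
  obtain g where g: "real_polynomial_function g" "\<And>x. x \<in> {l..u} \<Longrightarrow> \<bar>f x - g x\<bar> < e"
    using Stone_Weierstrass_real_polynomial_function[OF compact_Icc assms] by blast
  then obtain a n where a: "g = (\<lambda>x. \<Sum>i\<le>n. a i * x ^ i)"
    by (auto simp: real_polynomial_function_iff_sum)
  define p where "p = (\<Sum>i\<le>n. monom (complex_of_real (a i)) i)"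
  have p: "poly p (complex_of_real t) = complex_of_real (g t)" for t
    by (simp add: p_def a poly_sum poly_monom)
  show thesis
  proof
    show "real_coeffs p"
      by (auto simp: real_coeffs_def p_def coeff_sum intro!: sum_in_Reals)
    show "norm (poly p (complex_of_real t) - complex_of_real (f t)) < e" if "t \<in> {l..u}" for t
      using g(2)[OF that] unfolding p of_real_diff[symmetric] norm_of_real by (simp add: abs_minus_commute)
  qed
qed

text \<open>
  The first premise secures uniqueness: limits along \<open>f\<close> pin down \<open>T\<close> only if some sequence of polynomials
  converges to \<open>f\<close>.
\<close>

lemma cfc_eqI:
  assumes "uniform_limit {t. complex_of_real t \<in> op_spectrum H}
      (\<lambda>n t. poly (p n) (complex_of_real t)) f sequentially"
    and "\<And>q. uniform_limit {t. complex_of_real t \<in> op_spectrum H}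
        (\<lambda>n t. poly (q n) (complex_of_real t)) f sequentially \<Longrightarrow>
        (\<lambda>n. op_poly (q n) H) \<longlonglongrightarrow> T"
  shows "cfc f H = T"
  unfolding cfc_def
proof (rule the_equality)
  show "T' = T" if "\<forall>q. uniform_limit {t. complex_of_real t \<in> op_spectrum H}
        (\<lambda>n t. poly (q n) (complex_of_real t)) f sequentially \<longrightarrow>
        (\<lambda>n. op_poly (q n) H) \<longlonglongrightarrow> T'" for T'
    using that assms LIMSEQ_unique by blast
qed (use assms(2) in blast)

lemma cfc_poly:
  assumes H: "selfadjoint H"
  shows "cfc (\<lambda>t. poly P (complex_of_real t)) H = op_poly P H"
proof (rule cfc_eqI)
  show "uniform_limit {t. complex_of_real t \<in> op_spectrum H}
      (\<lambda>n t. poly P (complex_of_real t)) (\<lambda>t. poly P (complex_of_real t)) sequentially"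
    by (simp add: uniform_limit_iff)
next
  fix q
  assume lim: "uniform_limit {t. complex_of_real t \<in> op_spectrum H}
      (\<lambda>n t. poly (q n) (complex_of_real t)) (\<lambda>t. poly P (complex_of_real t)) sequentially"
  show "(\<lambda>n. op_poly (q n) H) \<longlonglongrightarrow> op_poly P H"
  proof (rule tendstoI)
    fix e :: real assume "e > 0"
    then have "\<forall>\<^sub>F n in sequentially. \<forall>t\<in>{t. complex_of_real t \<in> op_spectrum H}.
        dist (poly (q n) (complex_of_real t)) (poly P (complex_of_real t)) < e / 2"
      using uniform_limitD[OF lim, of "e / 2"] by simp
    then show "\<forall>\<^sub>F n in sequentially. dist (op_poly (q n) H) (op_poly P H) < e"
    proof eventually_elim
      case (elim n)
      have "norm (op_poly (q n - P) H) \<le> e / 2"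
        using elim \<open>e > 0\<close> by (intro norm_op_poly_le[OF H]) (auto simp: dist_norm less_imp_le)
      then show ?case
        using \<open>e > 0\<close> by (simp add: dist_norm op_poly_diff[OF selfadjoint_in_bop[OF H]])
    qed
  qed
qed

text \<open>
  The square root of \<open>B\<^sup>2\<close> is \<open>B\<close> itself when the spectrum of \<open>B\<close> is nonnegative. The function
  is prescribed on the half line only, so that this covers both \<open>sqrt\<close> and \<open>powr\<close>, which differ elsewhere.
\<close>

lemma cfc_sqrt_square:
  assumes B: "selfadjoint B"
    and nonneg: "\<And>t. complex_of_real t \<in> op_spectrum B \<Longrightarrow> t \<ge> 0"
    and g: "\<And>t. t \<ge> 0 \<Longrightarrow> g t = complex_of_real (sqrt t)"
  shows "cfc g (B o\<^sub>L B) = B"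
proof -
  have B': "B \<in> bop" by (rule selfadjoint_in_bop[OF B])
  have BB: "selfadjoint (B o\<^sub>L B)"
    using B by (auto simp: selfadjoint_def is_adjoint_def bop_compose)
  have BB_poly: "B o\<^sub>L B = op_poly [:0, 0, 1:] B"
    by (rule blinfun_eqI) (simp add: op_poly_pCons[OF B'] blinfun.bilinear_simps)
  define u where "u = norm (B o\<^sub>L B)"
  have "\<exists>p. \<forall>t\<in>{0..u}. norm (poly p (complex_of_real t) - complex_of_real (sqrt t)) < 1 / Suc n" for n
    by (rule Weierstrass_complex_poly[of 0 u sqrt "1 / Suc n"])
      (intro continuous_intros, simp, blast)
  then obtain p where p: "\<And>n t. t \<in> {0..u} \<Longrightarrow>
      norm (poly (p n) (complex_of_real t) - complex_of_real (sqrt t)) < 1 / Suc n"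
    by metis
  show ?thesis
  proof (rule cfc_eqI)
    show "uniform_limit {t. complex_of_real t \<in> op_spectrum (B o\<^sub>L B)}
        (\<lambda>n t. poly (p n) (complex_of_real t)) g sequentially"
    proof (rule uniform_limitI)
      fix e :: real assume "e > 0"
      have "\<forall>\<^sub>F n in sequentially. 1 / real (Suc n) < e"
        using order_tendstoD(2)[OF LIMSEQ_inverse_real_of_nat \<open>e > 0\<close>] by (simp add: inverse_eq_divide)
      then show "\<forall>\<^sub>F n in sequentially. \<forall>t\<in>{t. complex_of_real t \<in> op_spectrum (B o\<^sub>L B)}.
          dist (poly (p n) (complex_of_real t)) (g t) < e"
      proof eventually_elim
        case (elim n)
        show ?case
        proof
          fix t assume "t \<in> {t. complex_of_real t \<in> op_spectrum (B o\<^sub>L B)}"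
          then have "t \<ge> 0" "t \<le> u"
            using selfadjoint_square_spectrum_nonneg[OF B] selfadjoint_spectrum_bounded[OF BB]
            by (force simp: u_def)+
          then show "dist (poly (p n) (complex_of_real t)) (g t) < e"
            using p[of t n] elim by (simp add: dist_norm g)
        qed
      qed
    qed
  next
    fix q
    assume lim: "uniform_limit {t. complex_of_real t \<in> op_spectrum (B o\<^sub>L B)}
        (\<lambda>n t. poly (q n) (complex_of_real t)) g sequentially"
    show "(\<lambda>n. op_poly (q n) (B o\<^sub>L B)) \<longlonglongrightarrow> B"
    proof (rule tendstoI)
      fix e :: real assume "e > 0"
      then have "\<forall>\<^sub>F n in sequentially. \<forall>t\<in>{t. complex_of_real t \<in> op_spectrum (B o\<^sub>L B)}.
          dist (poly (q n) (complex_of_real t)) (g t) < e / 2"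
        using uniform_limitD[OF lim, of "e / 2"] by simp
      then show "\<forall>\<^sub>F n in sequentially. dist (op_poly (q n) (B o\<^sub>L B)) B < e"
      proof eventually_elim
        case (elim n)
        have "norm (op_poly (pcompose (q n) [:0, 0, 1:] - [:0, 1:]) B) \<le> e / 2"
        proof (rule norm_op_poly_le[OF B])
          fix t assume t: "complex_of_real t \<in> op_spectrum B"
          have "dist (poly (q n) (complex_of_real (t\<^sup>2))) (g (t\<^sup>2)) < e / 2"
            using elim spectrum_square[OF B' t] by blast
          then show "norm (poly (pcompose (q n) [:0, 0, 1:] - [:0, 1:]) (complex_of_real t)) \<le> e / 2"
            using nonneg[OF t] by (simp add: g dist_norm poly_pcompose power2_eq_square)
        qed (use \<open>e > 0\<close> in simp)
        moreover have "op_poly (pcompose (q n) [:0, 0, 1:] - [:0, 1:]) B = op_poly (q n) (B o\<^sub>L B) - B"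
          by (simp add: op_poly_diff[OF B'] op_poly_pcompose[OF B'] BB_poly
              op_poly_identity[OF B'])
        ultimately show ?case
          using \<open>e > 0\<close> by (simp add: dist_norm)
      qed
    qed
  qed
qed


section \<open>Traces that vanish on the square of the ideal\<close>

lemma commutant_closed:
  assumes "\<S> \<subseteq> bop"
  shows "id_blinfun \<in> commutant \<S>"
    and "S \<in> commutant \<S> \<Longrightarrow> T \<in> commutant \<S> \<Longrightarrow> S + T \<in> commutant \<S>"
    and "S \<in> commutant \<S> \<Longrightarrow> T \<in> commutant \<S> \<Longrightarrow> S o\<^sub>L T \<in> commutant \<S>"
    and "T \<in> commutant \<S> \<Longrightarrow> op_scaleC c T \<in> commutant \<S>"
proof -
  show "id_blinfun \<in> commutant \<S>" by (simp add: commutant_def)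
  show "S + T \<in> commutant \<S>" if "S \<in> commutant \<S>" "T \<in> commutant \<S>"
    using that by (simp add: commutant_def bop_add
        bounded_bilinear.add_left[OF bounded_bilinear_blinfun_compose]
        bounded_bilinear.add_right[OF bounded_bilinear_blinfun_compose])
  show "S o\<^sub>L T \<in> commutant \<S>" if "S \<in> commutant \<S>" "T \<in> commutant \<S>"
    using that by (simp add: commutant_def bop_compose compose_assoc)
      (simp add: compose_assoc[symmetric])
  show "op_scaleC c T \<in> commutant \<S>" if T: "T \<in> commutant \<S>"
  proof -
    have "op_scaleC c T o\<^sub>L R = R o\<^sub>L op_scaleC c T" if R: "R \<in> \<S>" for R
    proof (rule blinfun_eqI)
      fix x
      have "T o\<^sub>L R = R o\<^sub>L T" using T R by (simp add: commutant_def)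
      from arg_cong[OF this, of "\<lambda>Q. blinfun_apply Q x"] R assms
      show "blinfun_apply (op_scaleC c T o\<^sub>L R) x = blinfun_apply (R o\<^sub>L op_scaleC c T) x"
        by (simp add: bop_apply subset_iff)
    qed
    then show ?thesis using T by (simp add: commutant_def bop_scaleC)
  qed
qed

lemma von_neumann_algebra_closed:
  assumes "von_neumann_algebra \<B>"
  shows "id_blinfun \<in> \<B>"
    and "S \<in> \<B> \<Longrightarrow> T \<in> \<B> \<Longrightarrow> S + T \<in> \<B>"
    and "S \<in> \<B> \<Longrightarrow> T \<in> \<B> \<Longrightarrow> S o\<^sub>L T \<in> \<B>"
    and "T \<in> \<B> \<Longrightarrow> op_scaleC c T \<in> \<B>"
proof -
  have "commutant \<B> \<subseteq> bop" by (auto simp: commutant_def)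
  from commutant_closed[OF this] assms
  show "id_blinfun \<in> \<B>"
    and "S \<in> \<B> \<Longrightarrow> T \<in> \<B> \<Longrightarrow> S + T \<in> \<B>"
    and "S \<in> \<B> \<Longrightarrow> T \<in> \<B> \<Longrightarrow> S o\<^sub>L T \<in> \<B>"
    and "T \<in> \<B> \<Longrightarrow> op_scaleC c T \<in> \<B>"
    by (simp_all add: von_neumann_algebra_def)
qed

lemma op_poly_in_von_neumann_algebra:
  assumes "von_neumann_algebra \<B>" "T \<in> \<B>"
  shows "op_poly p T \<in> \<B>"
proof -
  have T: "T \<in> bop" using assms by (auto simp: von_neumann_algebra_def)
  have "0 \<in> \<B>"
    using von_neumann_algebra_closed(4)[OF assms, of 0] op_scaleC_of_real[of 0 T] by simp
  then show ?thesis
    by (induction p) (auto simp: op_poly_pCons[OF T] intro!: von_neumann_algebra_closed[OF assms(1)] assms)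
qed

lemma selfadjoint_compose_self: "selfadjoint W \<Longrightarrow> selfadjoint (W o\<^sub>L W)"
  by (auto simp: selfadjoint_def is_adjoint_def bop_compose)

text \<open>
  Fourth powers are used because here the square root \<open>W\<^sup>2\<close> of \<open>\<bar>W\<^sup>4\<bar>\<close> is in the ideal at once,
  whereas for \<open>W\<^sup>2\<close> one would have to show \<open>\<bar>W\<bar> \<in> \<I>\<close> by a polar decomposition.
\<close>

lemma fourth_power_in_ideal_power_2:
  assumes B: "von_neumann_algebra \<B>" and I: "op_ideal \<B> \<I>"
    and W: "W \<in> \<I>" "selfadjoint W"
  shows "(W o\<^sub>L W) o\<^sub>L (W o\<^sub>L W) \<in> ideal_power \<B> \<I> 2"
proof -
  define W2 where "W2 = W o\<^sub>L W"
  define W4 where "W4 = W2 o\<^sub>L W2"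
  have "W \<in> \<B>" using I W(1) by (auto simp: op_ideal_def)
  then have W2: "selfadjoint W2" "W2 \<in> \<I>" "W2 \<in> \<B>"
    using W I von_neumann_algebra_closed(3)[OF B] selfadjoint_compose_self
    by (auto simp: W2_def op_ideal_def)
  have W4: "selfadjoint W4" "W4 \<in> \<B>"
    using W2 von_neumann_algebra_closed(3)[OF B] selfadjoint_compose_self by (auto simp: W4_def)
  have "op_abs W4 = W4"
    unfolding op_abs_def adj_selfadjoint[OF W4(1)]
    using selfadjoint_square_spectrum_nonneg[OF W2(1)] unfolding W4_def[symmetric]
    by (intro cfc_sqrt_square W4) auto
  moreover have "op_powr W4 (1 / 2) = W2"
    unfolding op_powr_def W4_def
    using selfadjoint_square_spectrum_nonneg[OF W(2)] unfolding W2_def[symmetric]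
    by (intro cfc_sqrt_square W2) (auto simp: powr_half_sqrt)
  ultimately have "W4 \<in> ideal_power \<B> \<I> 2"
    using W2 W4 by (simp add: ideal_power_def)
  then show ?thesis by (simp add: W4_def W2_def)
qed

text \<open>Third differences of fourth powers are affine, so fourth powers span the polynomials.\<close>

lemma fourth_power_polarization:
  fixes q :: "complex poly"
  shows "smult 24 q = (q + [:3:]) ^ 4 + smult (-3) ((q + [:2:]) ^ 4) + smult 3 ((q + [:1:]) ^ 4)
    + smult (-1) (q ^ 4) + smult (-36) (1 ^ 4)"
proof -
  have c: "smult c p = [:c:] * p" for c and p :: "complex poly" by simp
  have "24 * q = (q + 3) ^ 4 + (-3) * ((q + 2) ^ 4) + 3 * ((q + 1) ^ 4) + (-1) * (q ^ 4) + (-36) * 1 ^ 4"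
    by (simp add: algebra_simps power4_eq_xxxx)
  moreover have "[:24:] = (24 :: complex poly)" "[:3:] = (3 :: complex poly)" "[:2:] = (2 :: complex poly)"
    "[:1:] = (1 :: complex poly)" "[:-3:] = (-3 :: complex poly)" "[:-1:] = (-1 :: complex poly)"
    "[:-36:] = (-36 :: complex poly)"
    by (simp_all add: numeral_poly one_pCons)
  ultimately show ?thesis by (simp only: c)
qed

lemma one_minus_power_factor:
  assumes "real_coeffs y"
  obtains e where "real_coeffs e" "1 = (1 - y) ^ n + y * e"
proof -
  have "\<exists>e. real_coeffs e \<and> 1 = (1 - y) ^ n + y * e"
  proof (induction n)
    case 0
    show ?case by (rule exI[of _ 0]) simp
  next
    case (Suc n)
    then obtain e where e: "real_coeffs e" "1 = (1 - y) ^ n + y * e" by blast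
    have "real_coeffs (e + (1 - y) ^ n)"
      using e(1) assms by (intro real_coeffs_add real_coeffs_power real_coeffs_diff)
        (auto simp: real_coeffs_pCons one_pCons)
    moreover have "(1 - y) ^ Suc n + y * (e + (1 - y) ^ n) = (1 - y) ^ n + y * e"
      by (simp add: algebra_simps)
    ultimately show ?case using e(2) by metis
  qed
  then show thesis using that by blast
qed

text \<open>Bernoulli's inequality gives \<open>(1 - u\<^sup>2)\<^sup>n \<le> 1 / (1 + n u\<^sup>2)\<close>, and \<open>\<bar>u\<bar> sqrt n \<le> 1 + n u\<^sup>2\<close>.\<close>

lemma abs_mult_one_minus_square_power_le:
  fixes u :: real
  assumes u: "\<bar>u\<bar> \<le> 1" and n: "n > 0"
  shows "\<bar>u\<bar> * (1 - u\<^sup>2) ^ n \<le> 1 / sqrt n"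
proof -
  have u2: "0 \<le> u\<^sup>2" "u\<^sup>2 \<le> 1" using u by (simp_all add: abs_square_le_1)
  have "1 + real n * u\<^sup>2 \<le> (1 + u\<^sup>2) ^ n"
    using Bernoulli_inequality[of "u\<^sup>2" n] u2 by linarith
  then have "(1 - u\<^sup>2) ^ n * (1 + real n * u\<^sup>2) \<le> (1 - u\<^sup>2) ^ n * (1 + u\<^sup>2) ^ n"
    using u2 by (intro mult_left_mono) auto
  also have "\<dots> = ((1 - u\<^sup>2) * (1 + u\<^sup>2)) ^ n" by (simp add: power_mult_distrib)
  also have "\<dots> \<le> 1"
  proof (rule power_le_one)
    show "0 \<le> (1 - u\<^sup>2) * (1 + u\<^sup>2)" using u2 by simp
    show "(1 - u\<^sup>2) * (1 + u\<^sup>2) \<le> 1" by (simp add: algebra_simps)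
  qed
  finally have *: "(1 - u\<^sup>2) ^ n * (1 + real n * u\<^sup>2) \<le> 1" .
  have "\<bar>u\<bar> * sqrt n \<le> 1 + real n * u\<^sup>2"
  proof -
    have "0 \<le> (\<bar>u\<bar> * sqrt n - 1)\<^sup>2" by simp
    then have "2 * (\<bar>u\<bar> * sqrt n) \<le> 1 + real n * u\<^sup>2"
      by (simp add: power2_diff power_mult_distrib mult.commute)
    moreover have "0 \<le> \<bar>u\<bar> * sqrt n" by simp
    ultimately show ?thesis by linarith
  qed
  then have "(1 - u\<^sup>2) ^ n * (\<bar>u\<bar> * sqrt n) \<le> (1 - u\<^sup>2) ^ n * (1 + real n * u\<^sup>2)"
    using u2 by (intro mult_left_mono) auto
  with * have "(1 - u\<^sup>2) ^ n * (\<bar>u\<bar> * sqrt n) \<le> 1" by linarith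
  then show ?thesis using n by (simp add: pos_le_divide_eq mult_ac)
qed

text \<open>
  Write \<open>L(p) = \<tau>(V p(V))\<close>. Fourth powers of \<open>V s(V)\<close> give \<open>L(t\<^sup>3 s(t)\<^sup>4) = 0\<close>, hence
  \<open>L(t\<^sup>3 q) = 0\<close> for all \<open>q\<close> because fourth powers span the polynomials. The functional \<open>L\<close> is bounded for
  the supremum norm on the spectrum, by the bound on \<open>\<tau>\<close> and \<open>N (V B) \<le> N V \<parallel>B\<parallel>\<close>. Finally
  \<open>t - t (1 - t\<^sup>2/\<rho>\<^sup>2)\<^sup>n\<close> is divisible by \<open>t\<^sup>3\<close> and converges uniformly to \<open>t\<close> on \<open>[-\<rho>, \<rho>]\<close>.
\<close>

lemma trace_vanishes_beyond_linear_term: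
  assumes B: "von_neumann_algebra \<B>" and I: "normed_ideal \<B> \<I> N"
    and \<tau>: "ideal_trace \<B> \<I> \<tau>" "bounded_trace \<I> N \<tau>" "\<tau> ` ideal_power \<B> \<I> 2 = {0}"
    and V: "V \<in> \<I>" "selfadjoint V" and q: "real_coeffs q"
  shows "\<tau> (op_poly ([:0, 1:] * ([:0, 1:] * q)) V) = 0"
proof -
  define X :: "complex poly" where "X = [:0, 1:]"
  define L where "L p = \<tau> (op_poly (X * p) V)" for p
  have ideal: "op_ideal \<B> \<I>" using I by (simp add: normed_ideal_def)
  have V': "V \<in> bop" "V \<in> \<B>"
    using V selfadjoint_in_bop ideal by (auto simp: op_ideal_def)
  have X_real: "real_coeffs X" by (simp add: X_def real_coeffs_pCons)
  have const_real: "real_coeffs [:complex_of_real c:]" for c by (simp add: real_coeffs_pCons)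
  have pV: "op_poly p V \<in> \<B>" for p
    by (rule op_poly_in_von_neumann_algebra[OF B V'(2)])
  have XV: "op_poly X V = V"
    by (simp add: X_def op_poly_identity[OF V'(1)])
  have Xp: "op_poly (X * p) V = V o\<^sub>L op_poly p V" for p
    by (simp add: op_poly_mult[OF V'(1)] XV)
  have Xp_mem: "op_poly (X * p) V \<in> \<I>" for p
    unfolding Xp using ideal V(1) pV by (auto simp: op_ideal_def)
  have L_add: "L (p + r) = L p + L r" for p r
    using \<tau>(1) Xp_mem by (simp add: L_def distrib_left op_poly_add[OF V'(1)] ideal_trace_def)
  have L_smult: "L (smult c p) = c * L p" for c p
    using \<tau>(1) Xp_mem by (simp add: L_def op_poly_smult[OF V'(1)] ideal_trace_def)
  have L_fourth: "L (X ^ 3 * s ^ 4) = 0" if s: "real_coeffs s" for s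
  proof -
    define W where "W = op_poly (X * s) V"
    have "selfadjoint W"
      unfolding W_def by (intro selfadjoint_op_poly V real_coeffs_mult X_real s)
    then have "\<tau> ((W o\<^sub>L W) o\<^sub>L (W o\<^sub>L W)) = 0"
      using fourth_power_in_ideal_power_2[OF B ideal Xp_mem[of s]] \<tau>(3) unfolding W_def by blast
    moreover have "X * (X ^ 3 * s ^ 4) = ((X * s) * (X * s)) * ((X * s) * (X * s))"
      by (simp add: power3_eq_cube power4_eq_xxxx mult_ac)
    ultimately show ?thesis
      by (simp only: L_def W_def op_poly_mult[OF V'(1), of "(X * s) * (X * s)"]
          op_poly_mult[OF V'(1), of "X * s" "X * s"])
  qed
  have L_cube: "L (X ^ 3 * r) = 0" if r: "real_coeffs r" for r
  proof -
    have shifted: "real_coeffs (r + [:of_real c:])" for c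
      by (intro real_coeffs_add r const_real)
    have one: "real_coeffs 1" using const_real[of 1] by (simp add: one_pCons)
    have "24 * L (X ^ 3 * r) = L (X ^ 3 * smult 24 r)"
      by (simp add: L_smult mult_smult_right)
    also have "\<dots> = 0"
      unfolding fourth_power_polarization[of r] distrib_left L_add mult_smult_right L_smult
      using L_fourth[OF shifted[of 3]] L_fourth[OF shifted[of 2]] L_fourth[OF shifted[of 1]]
        L_fourth[OF r] L_fourth[OF one]
      by simp
    finally show ?thesis by simp
  qed
  obtain M where M: "M > 0" "\<And>T. T \<in> \<I> \<Longrightarrow> norm (\<tau> T) \<le> M * N T"
    using \<tau>(2) unfolding bounded_trace_def by blast
  have NV: "N V \<ge> 0" using I V(1) by (simp add: normed_ideal_def)
  have L_bounded: "norm (L p) \<le> M * N V * norm (op_poly p V)" for p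
  proof -
    have "N (id_blinfun o\<^sub>L V o\<^sub>L op_poly p V) \<le> norm (id_blinfun :: 'a op) * N V * norm (op_poly p V)"
      using I V(1) pV von_neumann_algebra_closed(1)[OF B] by (auto simp: normed_ideal_def)
    also have "\<dots> \<le> 1 * N V * norm (op_poly p V)"
      by (intro mult_right_mono norm_blinfun_id_le NV norm_ge_zero)
    finally have "N (op_poly (X * p) V) \<le> N V * norm (op_poly p V)" by (simp add: Xp)
    then have "M * N (op_poly (X * p) V) \<le> M * (N V * norm (op_poly p V))"
      using M(1) by (intro mult_left_mono) auto
    then show ?thesis
      using M(2)[OF Xp_mem[of p]] by (simp add: L_def mult.assoc)
  qed
  define \<rho> where "\<rho> = norm V + 1"
  have \<rho>: "\<rho> > 0" by (simp add: \<rho>_def add_nonneg_pos)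
  have "compact ((\<lambda>t. poly q (complex_of_real t)) ` {-\<rho>..\<rho>})"
    by (intro compact_continuous_image compact_Icc continuous_intros)
  then obtain C where C: "C > 0" "\<And>t. t \<in> {-\<rho>..\<rho>} \<Longrightarrow> norm (poly q (complex_of_real t)) \<le> C"
    using compact_imp_bounded bounded_pos by (metis imageI)
  define y where "y = smult (complex_of_real (1 / \<rho>\<^sup>2)) (X * X)"
  have y_real: "real_coeffs y"
    using real_coeffs_mult[OF const_real[of "1 / \<rho>\<^sup>2"] real_coeffs_mult[OF X_real X_real]]
    by (simp add: y_def)
  have bound: "norm (L (X * q)) \<le> M * N V * (C * \<rho>) * (1 / sqrt n)" if n: "n > 0" for n :: nat
  proof -
    obtain e where e: "real_coeffs e" "1 = (1 - y) ^ n + y * e"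
      by (rule one_minus_power_factor[OF y_real])
    have "X * q = X * q * ((1 - y) ^ n + y * e)" using e(2) by simp
    also have "\<dots> = X * q * (1 - y) ^ n + smult (complex_of_real (1 / \<rho>\<^sup>2)) (X ^ 3 * (q * e))"
      by (simp add: y_def algebra_simps power3_eq_cube)
    finally have "L (X * q) = L (X * q * (1 - y) ^ n)"
      using L_cube[OF real_coeffs_mult[OF q e(1)]] by (metis L_add L_smult add.right_neutral mult_zero_right)
    also have "norm (L (X * q * (1 - y) ^ n)) \<le> M * N V * norm (op_poly (X * q * (1 - y) ^ n) V)"
      by (rule L_bounded)
    also have "\<dots> \<le> M * N V * (C * (\<rho> * (1 / sqrt n)))"
    proof (intro mult_left_mono norm_op_poly_le[OF V(2)])
      fix t assume "complex_of_real t \<in> op_spectrum V"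
      then have t: "\<bar>t\<bar> \<le> \<rho>"
        using selfadjoint_spectrum_bounded[OF V(2)] by (force simp: \<rho>_def)
      then have "t \<in> {-\<rho>..\<rho>}" by auto
      define u where "u = t / \<rho>"
      have u: "\<bar>u\<bar> \<le> 1" "t = \<rho> * u" using t \<rho> by (simp_all add: u_def)
      have u2: "u\<^sup>2 \<le> 1" using u(1) by (simp add: abs_square_le_1)
      have "poly y (complex_of_real t) = complex_of_real (u\<^sup>2)"
        using \<rho> by (simp add: y_def X_def u(2) power2_eq_square)
      then have "poly (X * q * (1 - y) ^ n) (complex_of_real t) =
          poly q (complex_of_real t) * complex_of_real (\<rho> * (u * (1 - u\<^sup>2) ^ n))"
        by (simp add: poly_power X_def u(2))
      then have "norm (poly (X * q * (1 - y) ^ n) (complex_of_real t)) =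
          norm (poly q (complex_of_real t)) * (\<rho> * (\<bar>u\<bar> * (1 - u\<^sup>2) ^ n))"
        using \<rho> u2 by (simp only: norm_mult norm_of_real abs_mult) (simp add: power_abs)
      also have "\<dots> \<le> C * (\<rho> * (1 / sqrt n))"
        using C(1) C(2)[OF \<open>t \<in> {-\<rho>..\<rho>}\<close>] \<rho> abs_mult_one_minus_square_power_le[OF u(1) n] u2
        by (intro mult_mono mult_left_mono) auto
      finally show "norm (poly (X * q * (1 - y) ^ n) (complex_of_real t)) \<le> C * (\<rho> * (1 / sqrt n))" .
    qed (use M(1) NV C(1) \<rho> in auto)
    finally show ?thesis by (simp add: mult.assoc)
  qed
  have "(\<lambda>n. M * N V * (C * \<rho>) * (1 / sqrt (real n))) \<longlonglongrightarrow> M * N V * (C * \<rho>) * 0"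
    by (intro tendsto_mult tendsto_const)
      (rule tendsto_divide_0[OF tendsto_const filterlim_at_top_imp_at_infinity],
       rule filterlim_compose[OF sqrt_at_top filterlim_real_sequentially])
  moreover have "\<forall>\<^sub>F n in sequentially. norm (L (X * q)) \<le> M * N V * (C * \<rho>) * (1 / sqrt (real n))"
    using eventually_gt_at_top[of 0] by eventually_elim (rule bound)
  ultimately have "norm (L (X * q)) \<le> M * N V * (C * \<rho>) * 0"
    by (rule tendsto_lowerbound) simp
  then show ?thesis by (simp add: L_def X_def)
qed

text \<open>In the Taylor expansion \<open>F(a + t) = p\<^sub>0 + p\<^sub>1 t + t\<^sup>2 R(t)\<close> the constant term cancels and
  the trace annihilates the remainder.\<close>

lemma trace_op_poly_diff:
  assumes B: "von_neumann_algebra \<B>" and I: "normed_ideal \<B> \<I> N"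
    and \<tau>: "ideal_trace \<B> \<I> \<tau>" "bounded_trace \<I> N \<tau>" "\<tau> ` ideal_power \<B> \<I> 2 = {0}"
    and V: "V \<in> \<I>" "selfadjoint V" and F: "real_coeffs F"
  shows "\<tau> (op_poly F (a *\<^sub>R id_blinfun + V) - op_poly F (a *\<^sub>R id_blinfun))
    = \<tau> V * poly (pderiv F) (complex_of_real a)"
proof -
  have V': "V \<in> bop" by (rule selfadjoint_in_bop[OF V(2)])
  define P where "P = pcompose F [:complex_of_real a, 1:]"
  have "real_coeffs (pcompose G [:complex_of_real a, 1:])" if "real_coeffs G" for G
    using that
    by (induction G) (auto simp: pcompose_pCons real_coeffs_pCons simp del: mult_pCons_left
        intro!: real_coeffs_add real_coeffs_mult)
  then have P_real: "real_coeffs P" using F by (simp add: P_def)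
  obtain p0 p1 R where P: "P = pCons p0 (pCons p1 R)"
    by (metis pCons_cases)
  have R: "real_coeffs R" using P_real by (simp add: P real_coeffs_pCons)
  have "a *\<^sub>R id_blinfun + V = op_poly [:complex_of_real a, 1:] V"
    by (simp add: op_poly_X[OF V'] op_scaleC_of_real)
  then have 1: "op_poly F (a *\<^sub>R id_blinfun + V) = op_poly P V"
    by (simp add: P_def op_poly_pcompose[OF V'])
  have "a *\<^sub>R id_blinfun = op_poly [:complex_of_real a:] V"
    by (simp add: op_poly_const[OF V'] op_scaleC_of_real)
  then have "op_poly F (a *\<^sub>R id_blinfun) = op_poly (pcompose F [:complex_of_real a:]) V"
    by (simp add: op_poly_pcompose[OF V'])
  also have "pcompose F [:complex_of_real a:] = [:p0:]"
  proof -
    have "p0 = poly P 0" by (simp add: P)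
    moreover have "pcompose G [:c:] = [:poly G c:]" for G and c :: complex
      by (induction G) (simp_all add: pcompose_pCons)
    ultimately show ?thesis by (simp add: P_def poly_pcompose)
  qed
  finally have "op_poly F (a *\<^sub>R id_blinfun + V) - op_poly F (a *\<^sub>R id_blinfun) = op_poly (P - [:p0:]) V"
    by (simp add: 1 op_poly_diff[OF V'])
  also have "P - [:p0:] = smult p1 [:0, 1:] + [:0, 1:] * ([:0, 1:] * R)"
    by (simp add: P)
  also have "\<tau> (op_poly \<dots> V) = p1 * \<tau> V"
  proof -
    have XV: "op_poly [:0, 1:] V = V"
      by (rule op_poly_identity[OF V'])
    have mem: "op_poly ([:0, 1:] * p) V \<in> \<I>" for p
    proof -
      have "op_poly p V \<in> \<B>"
        using I V(1) op_poly_in_von_neumann_algebra[OF B] by (auto simp: normed_ideal_def op_ideal_def)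
      then show ?thesis
        unfolding op_poly_mult[OF V'] XV using I V(1) by (simp add: normed_ideal_def op_ideal_def)
    qed
    have "op_scaleC p1 V \<in> \<I>" using I V(1) by (simp add: normed_ideal_def op_ideal_def)
    then have "\<tau> (op_scaleC p1 V + op_poly ([:0, 1:] * ([:0, 1:] * R)) V)
        = p1 * \<tau> V + \<tau> (op_poly ([:0, 1:] * ([:0, 1:] * R)) V)"
      using \<tau>(1) V(1) mem by (simp only: ideal_trace_def)
    then show ?thesis
      by (simp only: op_poly_add[OF V'] op_poly_smult[OF V'] XV
          trace_vanishes_beyond_linear_term[OF B I \<tau> V R] add_0_right)
  qed
  also have "p1 = poly (pderiv P) 0" by (simp add: P pderiv_pCons)
  also have "\<dots> = poly (pderiv F) (complex_of_real a)"
    by (simp add: P_def pderiv_pcompose poly_pcompose pderiv_pCons)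
  finally show ?thesis by (simp add: mult.commute)
qed


section \<open>The Jordan decomposition of a signed measure\<close>

definition signed_measure :: "'b measure \<Rightarrow> ('b set \<Rightarrow> real) \<Rightarrow> bool" where
  "signed_measure M \<nu> \<longleftrightarrow>
     (\<forall>E :: nat \<Rightarrow> 'b set. range E \<subseteq> sets M \<and> disjoint_family E
        \<longrightarrow> (\<lambda>n. \<nu> (E n)) sums \<nu> (\<Union>n. E n))"

lemma signed_measureD:
  "signed_measure M \<nu> \<Longrightarrow> range E \<subseteq> sets M \<Longrightarrow> disjoint_family E
    \<Longrightarrow> (\<lambda>n. \<nu> (E n)) sums \<nu> (\<Union>n::nat. E n)"
  by (simp add: signed_measure_def)

lemma signed_measure_uminus: "signed_measure M \<nu> \<Longrightarrow> signed_measure M (\<lambda>A. - \<nu> A)"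
  by (auto simp: signed_measure_def intro: sums_minus)

lemma signed_measure_empty:
  assumes "signed_measure M \<nu>"
  shows "\<nu> {} = 0"
proof -
  have "(\<lambda>n::nat. \<nu> {}) sums \<nu> (\<Union>n::nat. {})"
    by (rule signed_measureD[OF assms]) (auto simp: disjoint_family_on_def)
  then have "(\<lambda>n::nat. \<nu> {}) \<longlonglongrightarrow> 0"
    using summable_LIMSEQ_zero sums_summable by blast
  then show ?thesis by (simp add: LIMSEQ_const_iff)
qed

lemma signed_measure_Un:
  assumes "signed_measure M \<nu>" "A \<in> sets M" "B \<in> sets M" "A \<inter> B = {}"
  shows "\<nu> (A \<union> B) = \<nu> A + \<nu> B"
proof -
  have "(\<lambda>n. \<nu> (binaryset A B n)) sums \<nu> (\<Union>n. binaryset A B n)"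
    using assms by (intro signed_measureD[OF assms(1)])
      (auto simp: range_binaryset_eq disjoint_family_on_def binaryset_def)
  moreover have "(\<lambda>n. \<nu> (binaryset A B n)) sums (\<nu> A + \<nu> B)"
    by (rule binaryset_sums) (rule signed_measure_empty[OF assms(1)])
  ultimately show ?thesis
    unfolding UN_binaryset_eq by (rule sums_unique2)
qed

lemma signed_measure_split:
  assumes "signed_measure M \<nu>" "A \<in> sets M" "B \<in> sets M"
  shows "\<nu> A = \<nu> (A \<inter> B) + \<nu> (A - B)"
  using signed_measure_Un[OF assms(1), of "A \<inter> B" "A - B"] assms(2,3)
  by (simp add: Int_Diff_Un Diff_Int_distrib2 Int_commute sets.Int sets.Diff Int_Diff_disjoint)

text \<open>
  If \<open>\<nu>\<close> is unbounded on the subsets of \<open>A\<close>, a subset \<open>B\<close> with \<open>\<bar>\<nu> B\<bar> > \<bar>\<nu> A\<bar> + 1\<close> splits \<open>A\<close> into two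
  parts of absolute value at least \<open>1\<close>, and \<open>\<nu>\<close> remains unbounded on one of them. Iteration yields
  disjoint sets whose values cannot be summed.
\<close>

lemma signed_measure_bounded:
  assumes \<nu>: "signed_measure M \<nu>"
  obtains K where "\<And>A. A \<in> sets M \<Longrightarrow> \<bar>\<nu> A\<bar> \<le> K"
proof -
  define U where "U A \<longleftrightarrow> A \<in> sets M \<and> (\<forall>K. \<exists>B\<in>sets M. B \<subseteq> A \<and> \<bar>\<nu> B\<bar> > K)" for A
  have step: "\<exists>B. U B \<and> B \<subseteq> A \<and> \<bar>\<nu> (A - B)\<bar> \<ge> 1" if A: "U A" for A
  proof -
    obtain B where B: "B \<in> sets M" "B \<subseteq> A" "\<bar>\<nu> B\<bar> > \<bar>\<nu> A\<bar> + 1"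
      using A unfolding U_def by blast
    have A': "A \<in> sets M" using A by (simp add: U_def)
    have "\<nu> A = \<nu> B + \<nu> (A - B)"
      using signed_measure_split[OF \<nu> A' B(1)] B(2) by (simp add: Int_absorb1)
    then have diff: "\<bar>\<nu> (A - B)\<bar> \<ge> 1" "\<bar>\<nu> (A - (A - B))\<bar> \<ge> 1"
      using B(2,3) by (auto simp: double_diff)
    have "U B \<or> U (A - B)"
    proof (rule ccontr)
      assume "\<not> ?thesis"
      then obtain K1 K2 where
        K1: "\<And>C. C \<in> sets M \<Longrightarrow> C \<subseteq> B \<Longrightarrow> \<bar>\<nu> C\<bar> \<le> K1" and
        K2: "\<And>C. C \<in> sets M \<Longrightarrow> C \<subseteq> A - B \<Longrightarrow> \<bar>\<nu> C\<bar> \<le> K2"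
        using A' B(1) unfolding U_def by (meson not_less sets.Diff)
      obtain C where C: "C \<in> sets M" "C \<subseteq> A" "\<bar>\<nu> C\<bar> > K1 + K2"
        using A unfolding U_def by blast
      have "\<bar>\<nu> (C \<inter> B)\<bar> \<le> K1" "\<bar>\<nu> (C - B)\<bar> \<le> K2"
        using C B(1) by (auto intro!: K1 K2)
      then show False
        using signed_measure_split[OF \<nu> C(1) B(1)] C(3) by linarith
    qed
    then show ?thesis
      using diff B(2) by blast
  qed
  have "\<not> U (space M)"
  proof
    assume "U (space M)"
    then obtain A where A: "\<And>n. U (A n)" "\<And>n. A (Suc n) \<subseteq> A n" "\<And>n. \<bar>\<nu> (A n - A (Suc n))\<bar> \<ge> 1"
      using dependent_nat_choice[of "\<lambda>_. U" "\<lambda>_ A B. B \<subseteq> A \<and> \<bar>\<nu> (A - B)\<bar> \<ge> 1"] step by metis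
    have dec: "decseq A" by (rule decseq_SucI) (rule A(2))
    have "disjoint_family (\<lambda>n. A n - A (Suc n))"
    proof (unfold disjoint_family_on_def, intro ballI impI)
      have "(A m - A (Suc m)) \<inter> (A n - A (Suc n)) = {}" if "m < n" for m n
        using decseqD[OF dec, of "Suc m" n] that by auto
      then show "(A m - A (Suc m)) \<inter> (A n - A (Suc n)) = {}" if "m \<noteq> n" for m n
        using that by (metis Int_commute nat_neq_iff)
    qed
    moreover have "range (\<lambda>n. A n - A (Suc n)) \<subseteq> sets M"
      using A(1) by (auto simp: U_def)
    ultimately have "(\<lambda>n. \<nu> (A n - A (Suc n))) \<longlonglongrightarrow> 0"
      using signed_measureD[OF \<nu>] summable_LIMSEQ_zero sums_summable by blast
    from tendstoD[OF this, of 1]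
    have "\<forall>\<^sub>F n in sequentially. \<bar>\<nu> (A n - A (Suc n))\<bar> < 1"
      by (simp add: dist_norm)
    then show False
      using A(3) by (auto simp: eventually_sequentially not_less[symmetric])
  qed
  then obtain K where "\<And>A. A \<in> sets M \<Longrightarrow> \<bar>\<nu> A\<bar> \<le> K"
    unfolding U_def using sets.sets_into_space by (metis not_less sets.top)
  then show thesis using that by blast
qed

text \<open>
  The supremum that defines the positive variation, taken in the reals; signed measures are bounded, so
  that it is finite for them.
\<close>

definition upper_variation :: "'b measure \<Rightarrow> ('b set \<Rightarrow> real) \<Rightarrow> 'b set \<Rightarrow> real" where
  "upper_variation M \<nu> A = (SUP B\<in>{B \<in> sets M. B \<subseteq> A}. \<nu> B)"

lemma upper_variation_upper:
  assumes "signed_measure M \<nu>" "B \<in> sets M" "B \<subseteq> A"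
  shows "\<nu> B \<le> upper_variation M \<nu> A"
  unfolding upper_variation_def
proof (rule cSUP_upper)
  obtain K where "\<And>A. A \<in> sets M \<Longrightarrow> \<bar>\<nu> A\<bar> \<le> K"
    using signed_measure_bounded[OF assms(1)] by blast
  then show "bdd_above (\<nu> ` {B \<in> sets M. B \<subseteq> A})"
    by (intro bdd_aboveI[of _ K]) (auto dest: abs_le_D1)
qed (use assms in simp)

lemma upper_variation_least:
  assumes "\<And>B. B \<in> sets M \<Longrightarrow> B \<subseteq> A \<Longrightarrow> \<nu> B \<le> c"
  shows "upper_variation M \<nu> A \<le> c"
  unfolding upper_variation_def by (rule cSUP_least) (use assms in auto)

lemma upper_variation_nonneg: "signed_measure M \<nu> \<Longrightarrow> 0 \<le> upper_variation M \<nu> A"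
  using upper_variation_upper[of M \<nu> "{}" A] signed_measure_empty[of M \<nu>] by simp

lemma upper_variation_empty: "signed_measure M \<nu> \<Longrightarrow> upper_variation M \<nu> {} = 0"
  by (intro antisym upper_variation_nonneg upper_variation_least)
    (auto simp: signed_measure_empty)

lemma upper_variation_mono:
  assumes "signed_measure M \<nu>" "A \<subseteq> A'"
  shows "upper_variation M \<nu> A \<le> upper_variation M \<nu> A'"
  using assms by (intro upper_variation_least upper_variation_upper) auto

lemma upper_variation_superadditive:
  assumes \<nu>: "signed_measure M \<nu>" and disj: "A \<inter> A' = {}"
  shows "upper_variation M \<nu> A + upper_variation M \<nu> A' \<le> upper_variation M \<nu> (A \<union> A')"
proof -
  have sum_le: "\<nu> B + \<nu> B' \<le> upper_variation M \<nu> (A \<union> A')"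
    if "B \<in> sets M" "B \<subseteq> A" "B' \<in> sets M" "B' \<subseteq> A'" for B B'
  proof -
    have "\<nu> (B \<union> B') = \<nu> B + \<nu> B'"
      by (rule signed_measure_Un[OF \<nu>]) (use that disj in auto)
    moreover have "\<nu> (B \<union> B') \<le> upper_variation M \<nu> (A \<union> A')"
      by (rule upper_variation_upper[OF \<nu>]) (use that in auto)
    ultimately show ?thesis by simp
  qed
  have "upper_variation M \<nu> A \<le> upper_variation M \<nu> (A \<union> A') - \<nu> B'"
    if "B' \<in> sets M" "B' \<subseteq> A'" for B'
    by (rule upper_variation_least) (simp add: le_diff_eq sum_le that)
  then have "\<nu> B' \<le> upper_variation M \<nu> (A \<union> A') - upper_variation M \<nu> A"
    if "B' \<in> sets M" "B' \<subseteq> A'" for B'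
    using that by (simp add: le_diff_eq add.commute)
  then have "upper_variation M \<nu> A' \<le> upper_variation M \<nu> (A \<union> A') - upper_variation M \<nu> A"
    by (rule upper_variation_least)
  then show ?thesis by linarith
qed

lemma upper_variation_countably_additive:
  assumes \<nu>: "signed_measure M \<nu>" and E: "range E \<subseteq> sets M" "disjoint_family E"
  shows "(\<lambda>n. upper_variation M \<nu> (E n)) sums upper_variation M \<nu> (\<Union>n::nat. E n)"
proof -
  let ?P = "upper_variation M \<nu>"
  have partial: "(\<Sum>i<n. ?P (E i)) \<le> ?P (\<Union>i<n. E i)" for n
  proof (induction n)
    case 0
    show ?case by (simp add: upper_variation_empty[OF \<nu>])
  next
    case (Suc n)
    have "E i \<inter> E n = {}" if "i < n" for i
      using E(2) that by (simp add: disjoint_family_on_def)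
    then have "(\<Union>i<n. E i) \<inter> E n = {}" by blast
    from upper_variation_superadditive[OF \<nu> this] Suc show ?case
      by (simp add: lessThan_Suc Un_commute)
  qed
  have bound: "(\<Sum>i<n. ?P (E i)) \<le> ?P (\<Union>n. E n)" for n
    by (rule order_trans[OF partial upper_variation_mono[OF \<nu>]]) auto
  have summable: "summable (\<lambda>n. ?P (E n))"
    by (rule summableI_nonneg_bounded[OF upper_variation_nonneg[OF \<nu>] bound])
  have "(\<Sum>n. ?P (E n)) = ?P (\<Union>n. E n)"
  proof (rule antisym)
    show "(\<Sum>n. ?P (E n)) \<le> ?P (\<Union>n. E n)"
      by (rule suminf_le_const[OF summable bound])
    show "?P (\<Union>n. E n) \<le> (\<Sum>n. ?P (E n))"
    proof (rule upper_variation_least)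
      fix B assume B: "B \<in> sets M" "B \<subseteq> (\<Union>n. E n)"
      have "(\<lambda>n. \<nu> (B \<inter> E n)) sums \<nu> (\<Union>n. B \<inter> E n)"
        using E B by (intro signed_measureD[OF \<nu>]) (auto simp: disjoint_family_on_def)
      moreover have "(\<Union>n. B \<inter> E n) = B" using B(2) by auto
      ultimately have sums: "(\<lambda>n. \<nu> (B \<inter> E n)) sums \<nu> B" by simp
      have "\<nu> (B \<inter> E n) \<le> ?P (E n)" for n
        using E B by (intro upper_variation_upper[OF \<nu>]) auto
      then show "\<nu> B \<le> (\<Sum>n. ?P (E n))"
        using sums_le[OF _ sums summable_sums[OF summable]] by blast
    qed
  qed
  then show ?thesis using summable_sums[OF summable] by simp
qed

lemma sets_positive_variation [simp]: "sets (positive_variation M \<nu>) = sets M"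
  and space_positive_variation [simp]: "space (positive_variation M \<nu>) = space M"
  by (simp_all add: positive_variation_def sets.sets_measure_of_eq sets.space_measure_of_eq)

lemma emeasure_positive_variation:
  assumes \<nu>: "signed_measure M \<nu>" and A: "A \<in> sets M"
  shows "emeasure (positive_variation M \<nu>) A = ennreal (upper_variation M \<nu> A)"
proof -
  define \<phi> where "\<phi> A = (SUP B\<in>{B \<in> sets M. B \<subseteq> A}. ennreal (\<nu> B))" for A
  have \<phi>: "\<phi> A = ennreal (upper_variation M \<nu> A)" for A
  proof (rule antisym)
    show "\<phi> A \<le> ennreal (upper_variation M \<nu> A)"
      unfolding \<phi>_def by (intro SUP_least ennreal_leI upper_variation_upper[OF \<nu>]) auto
    then obtain r where r: "\<phi> A = ennreal r" "r \<ge> 0"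
      by (cases "\<phi> A") (auto simp: top_unique)
    have "\<nu> B \<le> r" if "B \<in> sets M" "B \<subseteq> A" for B
    proof -
      have "ennreal (\<nu> B) \<le> \<phi> A"
        unfolding \<phi>_def using that by (intro SUP_upper) simp
      then show ?thesis using r by (simp add: ennreal_le_iff)
    qed
    then show "ennreal (upper_variation M \<nu> A) \<le> \<phi> A"
      unfolding r(1) by (intro ennreal_leI upper_variation_least)
  qed
  have "emeasure (measure_of (space M) (sets M) \<phi>) A = \<phi> A"
  proof (rule emeasure_measure_of_sigma[OF sets.sigma_algebra_axioms _ _ A])
    show "positive (sets M) \<phi>"
      by (simp add: positive_def \<phi> upper_variation_empty[OF \<nu>])
    show "countably_additive (sets M) \<phi>"
    proof (rule countably_additiveI)
      fix E :: "nat \<Rightarrow> 'a set" assume E: "range E \<subseteq> sets M" "disjoint_family E"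
      show "(\<Sum>n. \<phi> (E n)) = \<phi> (\<Union>n. E n)"
        unfolding \<phi>
        by (rule sums_unique[symmetric], subst sums_ennreal)
          (auto intro: upper_variation_nonneg[OF \<nu>] upper_variation_countably_additive[OF \<nu> E])
    qed
  qed
  moreover have "positive_variation M \<nu> = measure_of (space M) (sets M) \<phi>"
    by (simp only: positive_variation_def \<phi>_def[abs_def])
  ultimately show ?thesis by (simp add: \<phi>)
qed

lemma finite_measure_positive_variation:
  "signed_measure M \<nu> \<Longrightarrow> finite_measure (positive_variation M \<nu>)"
  by (rule finite_measureI) (simp add: emeasure_positive_variation)

lemma measure_positive_variation:
  "signed_measure M \<nu> \<Longrightarrow> A \<in> sets M \<Longrightarrow>
    measure (positive_variation M \<nu>) A = upper_variation M \<nu> A"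
  by (simp add: measure_def emeasure_positive_variation upper_variation_nonneg)

text \<open>For \<open>B \<subseteq> A\<close>, \<open>\<nu> B = \<nu> A + (- \<nu>) (A - B)\<close>; take the supremum over \<open>B\<close>.\<close>

lemma Jordan_decomposition:
  assumes \<nu>: "signed_measure M \<nu>" and A: "A \<in> sets M"
  shows "\<nu> A = measure (positive_variation M \<nu>) A - measure (positive_variation M (\<lambda>A. - \<nu> A)) A"
proof -
  let ?\<mu> = "\<lambda>A. - \<nu> A"
  have \<mu>: "signed_measure M ?\<mu>" by (rule signed_measure_uminus[OF \<nu>])
  have split: "\<nu> A = \<nu> B + \<nu> (A - B)" if "B \<in> sets M" "B \<subseteq> A" for B
    using signed_measure_split[OF \<nu> A that(1)] that(2) by (simp add: Int_absorb1)
  have "upper_variation M \<nu> A \<le> \<nu> A + upper_variation M ?\<mu> A"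
  proof (rule upper_variation_least)
    fix B assume B: "B \<in> sets M" "B \<subseteq> A"
    show "\<nu> B \<le> \<nu> A + upper_variation M ?\<mu> A"
      using split[OF B] upper_variation_upper[OF \<mu>, of "A - B" A] A B by auto
  qed
  moreover have "upper_variation M ?\<mu> A \<le> - \<nu> A + upper_variation M \<nu> A"
  proof (rule upper_variation_least)
    fix B assume B: "B \<in> sets M" "B \<subseteq> A"
    show "- \<nu> B \<le> - \<nu> A + upper_variation M \<nu> A"
      using split[OF B] upper_variation_upper[OF \<nu>, of "A - B" A] A B by auto
  qed
  ultimately show ?thesis
    by (simp add: measure_positive_variation[OF \<nu> A] measure_positive_variation[OF \<mu> A])
qed


section \<open>Signed measures on bounded sets are determined by their moments\<close>

text \<open>
  By the Weierstrass theorem the hypothesis extends from polynomials to continuous functions, by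
  dominated convergence to half lines, and these generate the Borel sets.
\<close>

lemma signed_measure_eq_point_mass:
  fixes \<Omega> :: "real set" and \<nu> :: "real set \<Rightarrow> real"
  defines "M \<equiv> restrict_space borel \<Omega>"
  assumes \<nu>: "signed_measure M \<nu>" and \<Omega>: "\<Omega> \<subseteq> {l..u}" "a \<in> \<Omega>"
    and moments: "\<And>p. real_coeffs p \<Longrightarrow>
      (\<integral>t. Re (poly p (complex_of_real t)) \<partial>positive_variation M \<nu>) -
      (\<integral>t. Re (poly p (complex_of_real t)) \<partial>positive_variation M (\<lambda>A. - \<nu> A)) =
      c * Re (poly p (complex_of_real a))"
    and E: "E \<in> sets M"
  shows "\<nu> E = c * indicator E a"
proof -
  define P where "P = positive_variation M \<nu>"
  define Q where "Q = positive_variation M (\<lambda>A. - \<nu> A)"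
  interpret P: finite_measure P
    unfolding P_def by (rule finite_measure_positive_variation[OF \<nu>])
  interpret Q: finite_measure Q
    unfolding Q_def by (rule finite_measure_positive_variation[OF signed_measure_uminus[OF \<nu>]])
  have sets_M: "A \<inter> \<Omega> \<in> sets M" if "A \<in> sets borel" for A
    unfolding M_def sets_restrict_space using that by (auto simp: Int_commute)
  have space_PQ: "space P = \<Omega>" "space Q = \<Omega>"
    by (simp_all add: P_def Q_def M_def space_restrict_space)
  have meas: "f \<in> borel_measurable P" "f \<in> borel_measurable Q"
    if "f \<in> borel_measurable borel" for f :: "real \<Rightarrow> real"
  proof -
    have "f \<in> borel_measurable M"
      unfolding M_def by (rule measurable_restrict_space1[OF that])
    then show "f \<in> borel_measurable P" "f \<in> borel_measurable Q"
      by (simp_all add: P_def Q_def cong: measurable_cong_sets)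
  qed
  have Jordan: "\<nu> A = measure P A - measure Q A" if "A \<in> sets M" for A
    unfolding P_def Q_def by (rule Jordan_decomposition[OF \<nu> that])
  define D where "D f = integral\<^sup>L P f - integral\<^sup>L Q f" for f :: "real \<Rightarrow> real"
  have integrable: "integrable P f" "integrable Q f"
    if f: "f \<in> borel_measurable borel" and b: "\<And>t. t \<in> {l..u} \<Longrightarrow> \<bar>f t\<bar> \<le> b"
    for f :: "real \<Rightarrow> real" and b
    using \<Omega> b meas[OF f]
    by (auto intro!: P.integrable_const_bound[of _ b] Q.integrable_const_bound[of _ b] AE_I2
        simp: space_PQ subset_iff)
  have bounded: "\<exists>b. \<forall>t\<in>{l..u}. \<bar>f t\<bar> \<le> b" if "continuous_on UNIV f" for f :: "real \<Rightarrow> real"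
  proof -
    have "compact (f ` {l..u})"
      by (intro compact_continuous_image compact_Icc continuous_on_subset[OF that]) simp
    then show ?thesis
      using compact_imp_bounded bounded_real by (metis imageI)
  qed
  have continuous: "D f = c * f a" if f: "continuous_on UNIV f" for f :: "real \<Rightarrow> real"
  proof -
    define K where "K = measure P \<Omega> + measure Q \<Omega> + \<bar>c\<bar>"
    have approx: "\<bar>D f - c * f a\<bar> \<le> e * K" if e: "e > 0" for e
    proof -
      obtain p where p: "real_coeffs p"
        "\<And>t. t \<in> {l..u} \<Longrightarrow> norm (poly p (complex_of_real t) - complex_of_real (f t)) < e"
        using Weierstrass_complex_poly[OF continuous_on_subset[OF f subset_UNIV] e] by metis
      define g where "g = (\<lambda>t. Re (poly p (complex_of_real t)))"
      have g: "continuous_on UNIV g"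
        unfolding g_def by (intro continuous_intros)
      have fg: "\<bar>f t - g t\<bar> \<le> e" if "t \<in> {l..u}" for t
        using abs_Re_le_cmod[of "poly p (complex_of_real t) - complex_of_real (f t)"] p(2)[OF that]
        by (simp add: g_def abs_minus_commute)
      have int: "integrable P f" "integrable Q f" "integrable P g" "integrable Q g"
        using f g bounded[OF f] bounded[OF g] by (auto intro!: integrable borel_measurable_continuous_onI)
      have le_int: "\<bar>integral\<^sup>L R f - integral\<^sup>L R g\<bar> \<le> e * measure R \<Omega>"
        if R: "R = P \<or> R = Q" for R
      proof -
        interpret R: finite_measure R using R P.finite_measure_axioms Q.finite_measure_axioms by auto
        have R': "integrable R f" "integrable R g" "space R = \<Omega>" using R int space_PQ by auto
        have "\<bar>integral\<^sup>L R f - integral\<^sup>L R g\<bar> = \<bar>\<integral>t. f t - g t \<partial>R\<bar>" by (simp add: R')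
        also have "\<dots> \<le> (\<integral>t. \<bar>f t - g t\<bar> \<partial>R)" by (rule integral_abs_bound)
        also have "\<dots> \<le> (\<integral>t. e \<partial>R)"
          using fg \<Omega>(1) R' by (intro integral_mono) auto
        also have "\<dots> = e * measure R \<Omega>" by (simp add: R')
        finally show ?thesis .
      qed
      have Dg: "D g = c * g a"
        using moments[OF p(1)] unfolding D_def P_def Q_def g_def .
      have "\<bar>c * g a - c * f a\<bar> \<le> \<bar>c\<bar> * e"
        using fg[of a] \<Omega> by (auto simp: right_diff_distrib[symmetric] abs_mult abs_minus_commute
            intro!: mult_left_mono)
      then have "\<bar>D f - c * f a\<bar> \<le> e * measure P \<Omega> + e * measure Q \<Omega> + \<bar>c\<bar> * e"
        using le_int[of P] le_int[of Q] Dg unfolding D_def by (simp add: abs_le_iff)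
      then show ?thesis by (simp add: K_def algebra_simps)
    qed
    have "K \<ge> 0" by (simp add: K_def)
    have "\<bar>D f - c * f a\<bar> \<le> 0"
    proof (rule field_le_epsilon)
      fix e :: real assume "e > 0"
      then have "\<bar>D f - c * f a\<bar> \<le> (e / (K + 1)) * K"
        using \<open>K \<ge> 0\<close> by (intro approx) simp
      also have "\<dots> \<le> e"
        using \<open>K \<ge> 0\<close> \<open>e > 0\<close> by (simp add: field_simps)
      finally show "\<bar>D f - c * f a\<bar> \<le> 0 + e" by simp
    qed
    then show ?thesis by simp
  qed
  have half_line: "\<nu> ({..x} \<inter> \<Omega>) = c * indicator {..x} a" for x
  proof -
    define f where "f n t = max 0 (min 1 (1 - real n * (t - x)))" for n :: nat and t :: real
    have f_cont: "continuous_on UNIV (f n)" for n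
      unfolding f_def by (intro continuous_intros)
    have f_lim: "(\<lambda>n. f n t) \<longlonglongrightarrow> indicator {..x} t" for t
    proof (cases "t \<le> x")
      case True
      then have "f n t = indicator {..x} t" for n
        by (simp add: f_def min_def mult_nonneg_nonpos)
      then show ?thesis by simp
    next
      case False
      then obtain m :: nat where m: "1 < real m * (t - x)"
        using reals_Archimedean3[of "t - x"] by auto
      have "f n t = indicator {..x} t" if "n \<ge> m" for n
      proof -
        have "real m * (t - x) \<le> real n * (t - x)"
          using that False by (intro mult_right_mono) auto
        then have "1 - real n * (t - x) \<le> 0" using m by linarith
        then show ?thesis using False by (simp add: f_def)
      qed
      then show ?thesis
        by (intro tendsto_eventually) (auto simp: eventually_sequentially)
    qed
    have lim: "(\<lambda>n. integral\<^sup>L R (f n)) \<longlonglongrightarrow> measure R ({..x} \<inter> \<Omega>)" if R: "R = P \<or> R = Q" for R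
    proof -
      interpret R: finite_measure R using R P.finite_measure_axioms Q.finite_measure_axioms by auto
      have R': "space R = \<Omega>" "sets R = sets M" using R space_PQ by (auto simp: P_def Q_def)
      have R_meas: "h \<in> borel_measurable R" if "h \<in> borel_measurable borel" for h :: "real \<Rightarrow> real"
        using R meas[OF that] by auto
      have "(\<lambda>n. integral\<^sup>L R (f n)) \<longlonglongrightarrow> integral\<^sup>L R (indicator {..x})"
      proof (rule integral_dominated_convergence[where w = "\<lambda>_. 1"])
        show "AE t in R. norm (f n t) \<le> 1" for n
          by (rule AE_I2) (auto simp: f_def)
        show "f n \<in> borel_measurable R" for n
          by (intro R_meas borel_measurable_continuous_onI f_cont)
        show "(indicator {..x} :: real \<Rightarrow> real) \<in> borel_measurable R"
          by (rule R_meas) simp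
      qed (use f_lim in auto)
      also have "integral\<^sup>L R (indicator {..x}) = measure R ({..x} \<inter> \<Omega>)"
        using sets_M[of "{..x}"] by (simp add: R')
      finally show ?thesis .
    qed
    have "(\<lambda>n. D (f n)) \<longlonglongrightarrow> measure P ({..x} \<inter> \<Omega>) - measure Q ({..x} \<inter> \<Omega>)"
      unfolding D_def by (intro tendsto_diff lim) auto
    moreover have "(\<lambda>n. D (f n)) \<longlonglongrightarrow> c * indicator {..x} a"
      unfolding continuous[OF f_cont] by (intro tendsto_mult tendsto_const f_lim)
    ultimately show ?thesis
      using LIMSEQ_unique Jordan[OF sets_M[of "{..x}"]] by auto
  qed
  have total: "\<nu> \<Omega> = c"
  proof -
    have "D (\<lambda>_. 1) = c" using continuous[of "\<lambda>_. 1"] by simp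
    then show ?thesis
      using Jordan[of \<Omega>] sets_M[of UNIV] by (simp add: D_def space_PQ)
  qed
  have "\<nu> (A \<inter> \<Omega>) = c * indicator A a" if "A \<in> sets borel" for A
  proof -
    let ?G = "range (\<lambda>x::real. {..x})"
    have borel: "sets borel = sigma_sets UNIV ?G"
      by (subst borel_eq_atMost) (rule sets_measure_of, simp)
    have "Int_stable ?G"
      by (auto simp: Int_stable_def)
    moreover have "?G \<subseteq> Pow UNIV" by simp
    moreover have "A \<in> sigma_sets UNIV ?G" using that by (simp add: borel)
    ultimately show ?thesis
    proof (induction rule: sigma_sets_induct_disjoint)
      case (basic A)
      then show ?case using half_line by auto
    next
      case empty
      show ?case by (simp add: signed_measure_empty[OF \<nu>])
    next
      case (compl A)
      then have A: "A \<in> sets borel" by (simp add: borel)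
      have "\<nu> \<Omega> = \<nu> (\<Omega> \<inter> (A \<inter> \<Omega>)) + \<nu> (\<Omega> - (A \<inter> \<Omega>))"
        using sets_M[of UNIV] sets_M[OF A] by (intro signed_measure_split[OF \<nu>]) auto
      moreover have "\<Omega> \<inter> (A \<inter> \<Omega>) = A \<inter> \<Omega>" "\<Omega> - (A \<inter> \<Omega>) = (UNIV - A) \<inter> \<Omega>" by auto
      ultimately show ?case
        using compl.IH total by (cases "a \<in> A") simp_all
    next
      case (union A)
      have "(\<lambda>n. \<nu> (A n \<inter> \<Omega>)) sums \<nu> (\<Union>n. A n \<inter> \<Omega>)"
        using union.hyps by (intro signed_measureD[OF \<nu>])
          (auto simp: borel[symmetric] disjoint_family_on_def intro!: sets_M)
      moreover have "(\<lambda>n. c * indicator (A n) a) sums (c * indicator (\<Union>n. A n) a)"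
        using union.hyps(1) by (intro sums_mult indicator_sums) (auto simp: disjoint_family_on_def)
      ultimately show ?case
        unfolding union.IH by (simp add: sums_unique2)
    qed
  qed
  moreover obtain A where "A \<in> sets borel" "E = A \<inter> \<Omega>"
    using E unfolding M_def sets_restrict_space by (auto simp: Int_commute)
  ultimately show ?thesis using \<Omega>(2) by (simp add: indicator_def)
qed


section \<open>The spectral shift measure of a perturbation of a scalar\<close>

lemma real_coeffs_Reals:
  assumes "real_coeffs p"
  shows "poly p (complex_of_real t) = complex_of_real (Re (poly p (complex_of_real t)))"
proof -
  have "poly p (complex_of_real t) \<in> \<real>"
    using assms by (induction p) (auto simp: real_coeffs_pCons)
  then show ?thesis by simp
qed

lemma poly_antiderivative:
  assumes "real_coeffs p"
  obtains P where "real_coeffs P" "pderiv P = p"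
proof
  define P where "P = (\<Sum>i\<le>degree p. monom (coeff p i / of_nat (Suc i)) (Suc i))"
  show "real_coeffs P"
    using assms unfolding real_coeffs_def P_def
    by (auto simp: coeff_sum intro!: sum_in_Reals Reals_divide)
  have "pderiv P = (\<Sum>i\<le>degree p. monom (coeff p i) i)"
    unfolding P_def higher_pderiv_sum[of 1, simplified] pderiv_monom by (intro sum.cong) (auto simp del: of_nat_Suc)
  then show "pderiv P = p" by (simp add: poly_as_sum_of_monoms)
qed

lemma poly_has_vector_derivative:
  "((\<lambda>t. poly P (complex_of_real t)) has_vector_derivative poly (pderiv P) (complex_of_real t)) (at t)"
  using field_vector_diff_chain_at[of complex_of_real 1 t "poly P" "poly (pderiv P) (complex_of_real t)"]
    bounded_linear.has_vector_derivative[OF bounded_linear_of_real has_vector_derivative_id, of "at t"]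
    poly_DERIV[of P "complex_of_real t"]
  by (simp add: o_def)

lemma C_differentiable_poly: "C_differentiable k (\<lambda>t. poly P (complex_of_real t))"
  unfolding C_differentiable_def
  by (intro exI[of _ "\<lambda>i t. poly ((pderiv ^^ i) P) (complex_of_real t)"])
    (auto intro!: continuous_intros poly_has_vector_derivative)

lemma signed_measure_Re_Im:
  assumes "complex_measure M \<mu>"
  shows "signed_measure M (\<lambda>A. Re (\<mu> A))" "signed_measure M (\<lambda>A. Im (\<mu> A))"
  using assms by (auto simp: complex_measure_def signed_measure_def sums_complex_iff)

lemma selfadjoint_scalar: "selfadjoint (a *\<^sub>R id_blinfun)"
proof -
  have "selfadjoint (op_scaleC (complex_of_real a) (id_blinfun :: 'a op))"
    by (auto simp: selfadjoint_def is_adjoint_def cinner_scaleC_left cinner_scaleC_right intro: bop_scaleC)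
  then show ?thesis by (simp add: op_scaleC_of_real)
qed

lemma selfadjoint_add: "selfadjoint S \<Longrightarrow> selfadjoint T \<Longrightarrow> selfadjoint (S + T)"
  by (simp add: selfadjoint_def is_adjoint_def bop_add blinfun.bilinear_simps cinner_add_left
      cinner_add_right)

theorem proposition4p2:
  fixes \<B> \<I> :: "'a::complex_hilbert_space op set"
    and N :: "'a op \<Rightarrow> real"
    and \<tau> :: "'a op \<Rightarrow> complex"
    and H\<^sub>0 V :: "'a op"
    and a :: real
    and \<mu> :: "real set \<Rightarrow> complex"
  assumes "vn_factor \<B>" and "vn_sigma_finite \<B>" and "vn_semifinite \<B>"
    and "normed_ideal \<B> \<I> N"
    and "ideal_trace \<B> \<I> \<tau>" and "positive_trace \<I> \<tau>" and "bounded_trace \<I> N \<tau>"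
    and "\<tau> ` ideal_power \<B> \<I> 2 = {0}"
    and "H\<^sub>0 = a *\<^sub>R id_blinfun"
    and "V \<in> \<I>" and "selfadjoint V"
    and "spectral_shift_measure \<tau> H\<^sub>0 V \<mu>"
  shows "\<forall>E \<in> sets (hull_borel H\<^sub>0 V).
           \<mu> E = \<tau> V * complex_of_real (measure (return (hull_borel H\<^sub>0 V) a) E)"
proof
  note H0 = assms(9)
  let ?\<Omega> = "spectral_hull H\<^sub>0 V" and ?M = "hull_borel H\<^sub>0 V"
  fix E assume E: "E \<in> sets ?M"
  have B: "von_neumann_algebra \<B>" using assms(1) by (simp add: vn_factor_def)
  have \<mu>: "complex_measure ?M \<mu>"
    and shift: "\<And>f. C_differentiable 3 f \<Longrightarrow> \<tau> (cfc f (H\<^sub>0 + V) - cfc f H\<^sub>0) =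
          complex_measure_integral ?M \<mu> (\<lambda>t. vector_derivative f (at t))"
    using assms(12) by (auto simp: spectral_shift_measure_def)
  have sa: "selfadjoint H\<^sub>0" "selfadjoint (H\<^sub>0 + V)"
    unfolding H0 by (intro selfadjoint_add selfadjoint_scalar assms(11))+
  define \<nu>1 where "\<nu>1 = (\<lambda>A. Re (\<mu> A))"
  define \<nu>2 where "\<nu>2 = (\<lambda>A. Im (\<mu> A))"
  have \<nu>: "signed_measure ?M \<nu>1" "signed_measure ?M \<nu>2"
    unfolding \<nu>1_def \<nu>2_def by (rule signed_measure_Re_Im[OF \<mu>])+
  define D where "D \<nu> p = (\<integral>t. Re (poly p (complex_of_real t)) \<partial>positive_variation ?M \<nu>) -
      (\<integral>t. Re (poly p (complex_of_real t)) \<partial>positive_variation ?M (\<lambda>A. - \<nu> A))" for \<nu> p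
  have moments: "D \<nu>1 p = Re (\<tau> V) * Re (poly p (complex_of_real a))"
    "D \<nu>2 p = Im (\<tau> V) * Re (poly p (complex_of_real a))" if p: "real_coeffs p" for p
  proof -
    obtain P where P: "real_coeffs P" "pderiv P = p" by (rule poly_antiderivative[OF p])
    let ?f = "\<lambda>t. poly P (complex_of_real t)"
    have "complex_measure_integral ?M \<mu> (\<lambda>t. poly p (complex_of_real t)) =
        \<tau> (cfc ?f (H\<^sub>0 + V) - cfc ?f H\<^sub>0)"
      using shift[OF C_differentiable_poly[of 3 P]]
        vector_derivative_at[OF poly_has_vector_derivative[of P]] P(2) by simp
    also have "\<dots> = \<tau> V * poly p (complex_of_real a)"
      using trace_op_poly_diff[OF B assms(4,5,7,8,10,11) P(1), of a] P(2)
      by (simp add: cfc_poly[OF sa(1)] cfc_poly[OF sa(2)]) (simp add: H0)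
    finally have main: "complex_measure_integral ?M \<mu> (\<lambda>t. poly p (complex_of_real t)) =
        \<tau> V * complex_of_real (Re (poly p (complex_of_real a)))"
      using real_coeffs_Reals[OF p, of a] by simp
    have "signed_integral ?M \<nu> (\<lambda>t. poly p (complex_of_real t)) = complex_of_real (D \<nu> p)" for \<nu>
      unfolding signed_integral_def D_def by (subst (1 2) real_coeffs_Reals[OF p]) simp
    then have "complex_of_real (D \<nu>1 p) + \<i> * complex_of_real (D \<nu>2 p) =
        \<tau> V * complex_of_real (Re (poly p (complex_of_real a)))"
      using main by (simp add: complex_measure_integral_def \<nu>1_def \<nu>2_def)
    then show "D \<nu>1 p = Re (\<tau> V) * Re (poly p (complex_of_real a))"
      "D \<nu>2 p = Im (\<tau> V) * Re (poly p (complex_of_real a))"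
      by (simp_all add: complex_eq_iff)
  qed
  have return: "measure (return ?M a) E = indicator E a"
    using E by (simp add: measure_return)
  show "\<mu> E = \<tau> V * complex_of_real (measure (return ?M a) E)"
  proof (cases "\<exists>x::'a. x \<noteq> 0")
    case True
    have "\<not> bop_invertible (0 :: 'a op)"
    proof
      assume "bop_invertible (0 :: 'a op)"
      then obtain c where "c > 0" "\<And>x::'a. c * norm x \<le> norm (blinfun_apply (0 :: 'a op) x)"
        by (rule bop_invertible_bounded_below) blast
      then show False using True by (simp add: mult_le_0_iff)
    qed
    then have "complex_of_real a \<in> op_spectrum H\<^sub>0"
      by (simp add: mem_op_spectrum H0 op_scaleC_of_real)
    then have a: "a \<in> ?\<Omega>"
      unfolding spectral_hull_def by (intro hull_inc) simp
    define K where "K = max (norm H\<^sub>0) (norm (H\<^sub>0 + V))"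
    have "?\<Omega> \<subseteq> {-K..K}"
      unfolding spectral_hull_def
    proof (rule hull_minimal)
      show "{t. complex_of_real t \<in> op_spectrum H\<^sub>0 \<union> op_spectrum (H\<^sub>0 + V)} \<subseteq> {-K..K}"
        using selfadjoint_spectrum_bounded[OF sa(1)] selfadjoint_spectrum_bounded[OF sa(2)]
        by (fastforce simp: K_def abs_le_iff)
    qed simp
    then have "\<nu>1 E = Re (\<tau> V) * indicator E a" "\<nu>2 E = Im (\<tau> V) * indicator E a"
      using signed_measure_eq_point_mass[OF \<nu>(1) _ a] signed_measure_eq_point_mass[OF \<nu>(2) _ a]
        moments E unfolding D_def by blast+
    then show ?thesis
      unfolding return by (simp add: complex_eq_iff \<nu>1_def \<nu>2_def)
  next
    \<comment> \<open>On the zero space all spectra are empty, so \<open>E = {}\<close>.\<close>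
    case False
    then have "bop_invertible T" for T :: "'a op"
      unfolding bop_invertible_def by (intro bexI[of _ 0]) (auto intro!: blinfun_eqI)
    then have "?\<Omega> = {}"
      by (simp add: spectral_hull_def mem_op_spectrum)
    then have "E = {}" using E by (auto simp: sets_restrict_space)
    then show ?thesis
      using signed_measure_empty[OF \<nu>(1)] signed_measure_empty[OF \<nu>(2)]
      by (simp add: complex_eq_iff \<nu>1_def \<nu>2_def)
  qed
qed

end
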